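(* Let $\mathbb{H}$ be a complex Hilbert space and let $S\in\mathbb{B}(\mathbb{H})$. Then $$\omega(S)\le \frac12\max\left\{\left\| |S^*|+\left(|S^*|^{\frac12}|S||S^*|^{\frac12}\right)^{\frac12}\right\|,\ \left\| |S|+\left(|S|^{\frac12}|S^*||S|^{\frac12}\right)^{\frac12}\right\|\right\}\le \frac12\left(\|S\|+\sqrt{r\left(|S||S^*|\right)}\right).$$
   Context: $\mathbb{B}(\mathbb{H})$ is the $C^*$-algebra of bounded linear operators on the Hilbert space $\mathbb{H}$, with operator norm $\|\cdot\|$. For $X\in\mathbb{B}(\mathbb{H})$, $|X|=(X^*X)^{1/2}$, $r(X)$ is the spectral radius, and $\omega(X)=\sup_{\|x\|=1}|\langle Xx,x\rangle|$ is the numerical radius. Powers of positive operators are defined by the continuous functional calculus. *)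

theory Defs
  imports "HOL-Analysis.Analysis" "HOL-Computational_Algebra.Polynomial"
begin

text \<open>
  Complex Hilbert spaces. The library only has real inner product spaces, so a complex Hilbert space
  is presented as its underlying complete real inner product space (with inner product
  \<open>Re \<langle>x, y\<rangle>\<close>, which induces the same norm) together with the complex scalar multiplication and
  the complex inner product, linear in the first argument.
\<close>

class complex_hilbert_space = real_inner + complete_space +
  fixes scaleC :: "complex \<Rightarrow> 'a \<Rightarrow> 'a"  (infixr "*\<^sub>C" 75)
    and cinner :: "'a \<Rightarrow> 'a \<Rightarrow> complex"
  assumes scaleC_add_right: "c *\<^sub>C (x + y) = c *\<^sub>C x + c *\<^sub>C y"
    and scaleC_add_left: "(c + d) *\<^sub>C x = c *\<^sub>C x + d *\<^sub>C x"
    and scaleC_scaleC: "c *\<^sub>C (d *\<^sub>C x) = (c * d) *\<^sub>C x"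
    and scaleC_of_real: "complex_of_real r *\<^sub>C x = r *\<^sub>R x"
    and cinner_add_left: "cinner (x + y) z = cinner x z + cinner y z"
    and cinner_scaleC_left: "cinner (c *\<^sub>C x) y = c * cinner x y"
    and cinner_commute: "cinner x y = cnj (cinner y x)"
    and Re_cinner: "Re (cinner x y) = x \<bullet> y"

instantiation complex :: complex_hilbert_space
begin

definition scaleC_complex :: "complex \<Rightarrow> complex \<Rightarrow> complex"
  where "scaleC_complex c x = c * x"

definition cinner_complex :: "complex \<Rightarrow> complex \<Rightarrow> complex"
  where "cinner_complex x y = x * cnj y"

instance
  by standard
    (auto simp: scaleC_complex_def cinner_complex_def algebra_simps inner_complex_def
      scaleR_conv_of_real)

end

lemma norm_scaleC: "norm (c *\<^sub>C x) = cmod c * norm x"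
  for x :: "'a::complex_hilbert_space"
proof -
  have "cinner (c *\<^sub>C x) (c *\<^sub>C x) = c * cnj (c * cinner x x)"
    by (metis cinner_commute cinner_scaleC_left)
  also have "\<dots> = (c * cnj c) * cinner x x"
    by (metis cinner_commute complex_cnj_mult mult.assoc)
  also have "c * cnj c = complex_of_real ((cmod c)\<^sup>2)"
    by (rule complex_norm_square [symmetric])
  finally have "(c *\<^sub>C x) \<bullet> (c *\<^sub>C x) = (cmod c)\<^sup>2 * (x \<bullet> x)"
    by (simp flip: Re_cinner)
  then show ?thesis
    by (simp add: norm_eq_sqrt_inner real_sqrt_mult)
qed

text \<open>
  \<open>\<bool>(\<H>)\<close>: the library type \<open>'a \<Rightarrow>\<^sub>L 'a\<close> consists of the bounded \<^emph>\<open>real\<close>-linear maps, normed by the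
  operator norm; its complex-linear members are selected by a predicate.
\<close>

definition bounded_operators :: "('a::complex_hilbert_space \<Rightarrow>\<^sub>L 'a) set"
  where "bounded_operators = {T. \<forall>c x. blinfun_apply T (c *\<^sub>C x) = c *\<^sub>C blinfun_apply T x}"

lift_definition scalar_op :: "complex \<Rightarrow> 'a::complex_hilbert_space \<Rightarrow>\<^sub>L 'a"
  is "\<lambda>c x. c *\<^sub>C x"
proof (intro bounded_linear_intro)
  fix c :: complex and x y :: 'a and r :: real
  show "c *\<^sub>C (x + y) = c *\<^sub>C x + c *\<^sub>C y"
    by (rule scaleC_add_right)
  show "c *\<^sub>C (r *\<^sub>R x) = r *\<^sub>R (c *\<^sub>C x)"
    by (simp add: scaleC_scaleC mult.commute flip: scaleC_of_real)
  show "norm (c *\<^sub>C x) \<le> norm x * cmod c"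
    by (simp add: norm_scaleC)
qed

definition adj :: "('a::complex_hilbert_space \<Rightarrow>\<^sub>L 'a) \<Rightarrow> 'a \<Rightarrow>\<^sub>L 'a"
  where "adj T = (THE A. A \<in> bounded_operators \<and>
    (\<forall>x y. cinner (blinfun_apply T x) y = cinner x (blinfun_apply A y)))"

definition spectrum :: "('a::complex_hilbert_space \<Rightarrow>\<^sub>L 'a) \<Rightarrow> complex set"
  where "spectrum T = {z. \<not> (\<exists>R\<in>bounded_operators.
    R o\<^sub>L (T - scalar_op z) = id_blinfun \<and> (T - scalar_op z) o\<^sub>L R = id_blinfun)}"

text \<open>
  In the following two suprema of sets of nonnegative reals, inserting \<open>0\<close> only matters for the zero
  space, where there are no unit vectors and the spectrum is empty: the supremum of the empty set,
  unspecified for type \<^typ>\<open>real\<close>, is then \<open>0\<close>.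
\<close>

definition spectral_radius :: "('a::complex_hilbert_space \<Rightarrow>\<^sub>L 'a) \<Rightarrow> real"
  where "spectral_radius T = Sup (insert 0 (cmod ` spectrum T))"

definition numerical_radius :: "('a::complex_hilbert_space \<Rightarrow>\<^sub>L 'a) \<Rightarrow> real"
  where "numerical_radius T =
    Sup (insert 0 {cmod (cinner (blinfun_apply T x) x) | x. norm x = 1})"

definition poly_op :: "real poly \<Rightarrow> ('a::complex_hilbert_space \<Rightarrow>\<^sub>L 'a) \<Rightarrow> 'a \<Rightarrow>\<^sub>L 'a"
  where "poly_op p T = (\<Sum>i\<le>degree p. coeff p i *\<^sub>R ((\<lambda>A. T o\<^sub>L A) ^^ i) id_blinfun)"

text \<open>
  Continuous functional calculus \<open>f(T)\<close> for self-adjoint \<open>T\<close> and \<open>f\<close> real-valued and continuous on the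
  (then real) spectrum of \<open>T\<close>: the norm limit of \<open>p\<^sub>n(T)\<close> for any real polynomials \<open>p\<^sub>n\<close>
  converging to \<open>f\<close> uniformly on the spectrum. No meaning is intended for other \<open>T\<close> or \<open>f\<close>.
\<close>

definition cfc :: "(real \<Rightarrow> real) \<Rightarrow> ('a::complex_hilbert_space \<Rightarrow>\<^sub>L 'a) \<Rightarrow> 'a \<Rightarrow>\<^sub>L 'a"
  where "cfc f T = (THE A. \<forall>p :: nat \<Rightarrow> real poly.
    uniform_limit {t. complex_of_real t \<in> spectrum T} (\<lambda>n. poly (p n)) f sequentially
      \<longrightarrow> (\<lambda>n. poly_op (p n) T) \<longlonglongrightarrow> A)"

text \<open>Powers \<open>T\<^sup>a\<close> of positive operators, for exponents \<open>a > 0\<close>.\<close>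

definition powr_op :: "('a::complex_hilbert_space \<Rightarrow>\<^sub>L 'a) \<Rightarrow> real \<Rightarrow> 'a \<Rightarrow>\<^sub>L 'a"
  where "powr_op T a = cfc (\<lambda>t. t powr a) T"

definition abs_op :: "('a::complex_hilbert_space \<Rightarrow>\<^sub>L 'a) \<Rightarrow> 'a \<Rightarrow>\<^sub>L 'a"
  where "abs_op X = powr_op (adj X o\<^sub>L X) (1/2)"

end

theory Submission
  imports Defs "HOL-Computational_Algebra.Fundamental_Theorem_Algebra"
begin

text \<open>
  Put \<open>A = |S\<^sup>*|\<close> and \<open>B = |S|\<close>. The mixed Schwarz inequality
  \<open>2 Re \<langle>X v, u\<rangle> \<le> \<langle>|X\<^sup>*| u, u\<rangle> + \<langle>|X| v, v\<rangle>\<close> for \<open>X = S\<close> gives \<open>\<omega>(S) \<le> \<parallel>A + B\<parallel> / 2\<close>. For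
  \<open>X = A\<^sup>1\<^sup>/\<^sup>2 B\<^sup>1\<^sup>/\<^sup>2\<close> it says that the off-diagonal part of the block operator
  \<open>[[A, X], [X\<^sup>*, B]]\<close>, whose norm is \<open>\<parallel>A + B\<parallel>\<close>, is dominated by \<open>diag(|X\<^sup>*|, |X|)\<close>, whence
  \<open>\<parallel>A + B\<parallel> \<le> max {\<parallel>A + |X\<^sup>*|\<parallel>, \<parallel>B + |X|\<parallel>}\<close>. Finally \<open>\<parallel>X\<parallel>\<^sup>2 = \<parallel>A\<^sup>1\<^sup>/\<^sup>2 B A\<^sup>1\<^sup>/\<^sup>2\<parallel>\<close> is in the spectrum of this
  operator, hence (if nonzero) in that of \<open>B A\<close>.

  The functional calculus rests on the bound of \<open>\<parallel>p(T)\<parallel>\<close> by the supremum of \<open>|p|\<close> on the spectrum of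
  a self-adjoint \<open>T\<close>: a real polynomial without zeros in the spectrum factors into terms \<open>x - t\<close> and
  \<open>(x - a)\<^sup>2 + b\<^sup>2\<close> that are bounded below at \<open>T\<close>. All of this only uses the underlying real inner
  product.
\<close>

subsection \<open>Symmetric operators on real inner product spaces\<close>

text \<open>Stands in for invertibility: a symmetric operator on a complete space with this property
  is onto, see \<open>symmetric_bounded_below_surj\<close>.\<close>

definition bounded_below :: "('b::real_normed_vector \<Rightarrow>\<^sub>L 'b) \<Rightarrow> bool"
  where "bounded_below T \<longleftrightarrow> (\<exists>c>0. \<forall>x. c * norm x \<le> norm (T x))"

definition symmetric_op :: "('b::real_inner \<Rightarrow>\<^sub>L 'b) \<Rightarrow> bool"
  where "symmetric_op T \<longleftrightarrow> (\<forall>x y. T x \<bullet> y = x \<bullet> T y)"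

text \<open>Symmetry is demanded because a nonnegative real quadratic form does not imply it, as
  rotation by a right angle shows.\<close>

definition positive_op :: "('b::real_inner \<Rightarrow>\<^sub>L 'b) \<Rightarrow> bool"
  where "positive_op T \<longleftrightarrow> symmetric_op T \<and> (\<forall>x. 0 \<le> T x \<bullet> x)"

lemma blinfun_inner_bound: "\<bar>T x \<bullet> x\<bar> \<le> norm T * (norm x)\<^sup>2"
  for T :: "'b::real_inner \<Rightarrow>\<^sub>L 'b"
proof -
  have "\<bar>T x \<bullet> x\<bar> \<le> norm (T x) * norm x"
    by (rule Cauchy_Schwarz_ineq2)
  also have "\<dots> \<le> norm T * norm x * norm x"
    by (intro mult_right_mono norm_blinfun) auto
  finally show ?thesis
    by (simp add: power2_eq_square mult.assoc)
qed

lemma bounded_below_if_coercive: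
  fixes T :: "'b::real_inner \<Rightarrow>\<^sub>L 'b"
  assumes "\<delta> > 0" and "\<And>x. \<delta> * (norm x)\<^sup>2 \<le> \<bar>T x \<bullet> x\<bar>"
  shows "bounded_below T"
  unfolding bounded_below_def
proof (intro exI[of _ \<delta>] conjI allI)
  fix x
  have "\<delta> * norm x * norm x \<le> norm (T x) * norm x"
    using assms(2)[of x] Cauchy_Schwarz_ineq2[of "T x" x]
    by (simp add: power2_eq_square mult.assoc)
  then show "\<delta> * norm x \<le> norm (T x)"
    by (cases "x = 0") auto
qed (use assms in simp)

lemma bounded_below_compose:
  assumes "bounded_below T" "bounded_below U"
  shows "bounded_below (T o\<^sub>L U)"
proof -
  obtain c where c: "c > 0" "\<And>x. c * norm x \<le> norm (T x)"
    using assms(1) unfolding bounded_below_def by blast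
  obtain d where d: "d > 0" "\<And>x. d * norm x \<le> norm (U x)"
    using assms(2) unfolding bounded_below_def by blast
  have "c * d * norm x \<le> norm (T (U x))" for x
    using order_trans[OF mult_left_mono[OF d(2)[of x], of c] c(2)[of "U x"]] c(1)
    by (simp add: mult.assoc)
  then show ?thesis
    unfolding bounded_below_def using c(1) d(1) by (intro exI[of _ "c * d"]) auto
qed

lemma bounded_below_right_factor:
  assumes "bounded_below (T o\<^sub>L U)"
  shows "bounded_below U"
proof -
  obtain c where c: "c > 0" "\<And>x. c * norm x \<le> norm (T (U x))"
    using assms unfolding bounded_below_def by auto
  have "c / (norm T + 1) * norm x \<le> norm (U x)" for x
  proof -
    have "c * norm x \<le> norm T * norm (U x)"
      using c(2) norm_blinfun order_trans by blast
    also have "\<dots> \<le> (norm T + 1) * norm (U x)"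
      by (intro mult_right_mono) auto
    finally show ?thesis
      by (simp add: field_simps add_pos_nonneg)
  qed
  then show ?thesis
    unfolding bounded_below_def using c(1)
    by (intro exI[of _ "c / (norm T + 1)"]) (auto intro!: divide_pos_pos add_nonneg_pos)
qed

lemma symmetric_opD: "symmetric_op T \<Longrightarrow> T x \<bullet> y = x \<bullet> T y"
  by (simp add: symmetric_op_def)

lemma symmetric_op_id: "symmetric_op id_blinfun"
  by (simp add: symmetric_op_def)

lemma symmetric_op_add: "symmetric_op T \<Longrightarrow> symmetric_op U \<Longrightarrow> symmetric_op (T + U)"
  by (simp add: symmetric_op_def blinfun.add_left inner_simps)

lemma symmetric_op_diff: "symmetric_op T \<Longrightarrow> symmetric_op U \<Longrightarrow> symmetric_op (T - U)"
  by (simp add: symmetric_op_def blinfun.diff_left inner_simps)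

lemma symmetric_op_scaleR: "symmetric_op T \<Longrightarrow> symmetric_op (c *\<^sub>R T)"
  by (simp add: symmetric_op_def blinfun.scaleR_left)

lemmas symmetric_op_intros =
  symmetric_op_id symmetric_op_add symmetric_op_diff symmetric_op_scaleR

text \<open>Expand the nonnegative form at \<open>x - s *\<^sub>R y\<close> with
  \<open>y = K x\<close>; once \<open>K y \<bullet> y\<close> is estimated by the norm,
  \<open>s = 1 / norm K\<close> is the best choice.\<close>

lemma positive_op_norm_sq:
  fixes K :: "'b::real_inner \<Rightarrow>\<^sub>L 'b"
  assumes "positive_op K"
  shows "(norm (K x))\<^sup>2 \<le> norm K * (K x \<bullet> x)"
proof (cases "K = 0")
  case False
  define y where "y = K x"
  define s where "s = 1 / norm K"
  have N: "norm K > 0"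
    using False by simp
  have sym: "symmetric_op K"
    using assms by (simp add: positive_op_def)
  have "0 \<le> K (x - s *\<^sub>R y) \<bullet> (x - s *\<^sub>R y)"
    using assms by (simp add: positive_op_def)
  also have "\<dots> = K x \<bullet> x - 2 * s * (y \<bullet> y) + s\<^sup>2 * (K y \<bullet> y)"
    using symmetric_opD[OF sym, of y x]
    by (simp add: blinfun.diff_right blinfun.scaleR_right inner_simps y_def inner_commute
        power2_eq_square algebra_simps)
  also have "\<dots> \<le> K x \<bullet> x - 2 * s * (y \<bullet> y) + s\<^sup>2 * (norm K * (y \<bullet> y))"
    using blinfun_inner_bound[of K y] by (intro add_left_mono mult_left_mono)
      (auto simp: power2_norm_eq_inner)
  also have "\<dots> = K x \<bullet> x - (y \<bullet> y) / norm K"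
    using N by (simp add: s_def field_simps power2_eq_square)
  finally show ?thesis
    using N by (simp add: y_def power2_norm_eq_inner field_simps)
qed auto

text \<open>Polarisation writes \<open>H x \<bullet> y\<close> through two values of the form, and
  the parallelogram law adds up their bounds.\<close>

lemma norm_symmetric_op_le:
  fixes H :: "'b::real_inner \<Rightarrow>\<^sub>L 'b"
  assumes "symmetric_op H" and M: "M \<ge> 0" "\<And>x. \<bar>H x \<bullet> x\<bar> \<le> M * (norm x)\<^sup>2"
  shows "norm H \<le> M"
proof (rule norm_blinfun_bound)
  fix x
  show "norm (H x) \<le> M * norm x"
  proof (cases "H x = 0")
    case False
    then have x: "norm x > 0" "norm (H x) > 0"
      by (auto simp: blinfun.zero_right)
    \<comment> \<open>The vector of the same norm as \<open>x\<close> in the direction of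
      \<open>H x\<close>.\<close>
    define y where "y = (norm x / norm (H x)) *\<^sub>R H x"
    have ny: "norm y = norm x"
      using x by (simp add: y_def)
    have "4 * (H x \<bullet> y) = H (x + y) \<bullet> (x + y) - H (x - y) \<bullet> (x - y)"
      using symmetric_opD[OF assms(1), of y x]
      by (simp add: blinfun.add_right blinfun.diff_right inner_simps inner_commute)
    also have "\<dots> \<le> M * (norm (x + y))\<^sup>2 + M * (norm (x - y))\<^sup>2"
      using M(2)[of "x + y"] M(2)[of "x - y"] by linarith
    also have "\<dots> = M * (4 * (norm x)\<^sup>2)"
    proof -
      have "(norm (x + y))\<^sup>2 + (norm (x - y))\<^sup>2 = 2 * (norm x)\<^sup>2 + 2 * (norm y)\<^sup>2"
        by (simp add: power2_norm_eq_inner inner_simps inner_commute)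
      then show ?thesis
        using ny by (simp flip: distrib_left)
    qed
    finally have "H x \<bullet> y \<le> M * (norm x)\<^sup>2"
      by simp
    moreover have "H x \<bullet> y = norm x * norm (H x)"
      using x by (simp add: y_def dot_square_norm power2_eq_square)
    ultimately show ?thesis
      using x by (simp add: power2_eq_square mult.assoc mult.commute)
  qed (use M(1) in simp)
qed (fact M(1))

text \<open>Squaring the lower bound and applying \<open>positive_op_norm_sq\<close> trades the norm
  of \<open>K x\<close> for the form.\<close>

lemma positive_op_coercive_if_bounded_below:
  fixes K :: "'b::real_inner \<Rightarrow>\<^sub>L 'b"
  assumes "positive_op K" "bounded_below K"
  obtains \<delta> where "\<delta> > 0" "\<And>x. \<delta> * (norm x)\<^sup>2 \<le> K x \<bullet> x"
proof -
  obtain c where c: "c > 0" "\<And>x. c * norm x \<le> norm (K x)"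
    using assms(2) unfolding bounded_below_def by blast
  have "c\<^sup>2 / (norm K + 1) * (norm x)\<^sup>2 \<le> K x \<bullet> x" for x
  proof -
    have "c\<^sup>2 * (norm x)\<^sup>2 = (c * norm x)\<^sup>2"
      by (simp add: power_mult_distrib)
    also have "\<dots> \<le> (norm (K x))\<^sup>2"
      using c by (intro power_mono) auto
    also have "\<dots> \<le> norm K * (K x \<bullet> x)"
      by (rule positive_op_norm_sq[OF assms(1)])
    also have "\<dots> \<le> (norm K + 1) * (K x \<bullet> x)"
      using assms(1) by (intro mult_right_mono) (auto simp: positive_op_def)
    finally show ?thesis
      by (simp add: field_simps add_pos_nonneg)
  qed
  moreover have "c\<^sup>2 / (norm K + 1) > 0"
    using c(1) by (intro divide_pos_pos add_nonneg_pos) auto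
  ultimately show ?thesis
    using that by blast
qed

text \<open>Otherwise the infimum of the quadratic form on the unit sphere is a negative approximate
  eigenvalue.\<close>

lemma positive_op_if_bounded_below:
  fixes H :: "'b::real_inner \<Rightarrow>\<^sub>L 'b"
  assumes sym: "symmetric_op H" and bb: "\<And>t. t < 0 \<Longrightarrow> bounded_below (H - t *\<^sub>R id_blinfun)"
  shows "positive_op H"
proof (rule ccontr)
  assume "\<not> positive_op H"
  then obtain x where x: "H x \<bullet> x < 0"
    using sym by (auto simp: positive_op_def not_le)
  then have nx: "norm x > 0"
    by auto
  \<comment> \<open>Lower bounds of the form on the unit sphere, written homogeneously; their
    supremum \<open>m\<close> is the infimum of the form there.\<close>
  define S where "S = {m. \<forall>y. m * (norm y)\<^sup>2 \<le> H y \<bullet> y}"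
  define m where "m = Sup S"
  have ub: "s \<le> (H x \<bullet> x) / (norm x)\<^sup>2" if "s \<in> S" for s
    using that nx by (simp add: S_def field_simps)
  then have bdd: "bdd_above S"
    by (intro bdd_aboveI) auto
  have "- norm H \<in> S"
    using blinfun_inner_bound[of H] by (auto simp: S_def abs_le_iff minus_le_iff)
  then have ne: "S \<noteq> {}"
    by auto
  have "m \<le> (H x \<bullet> x) / (norm x)\<^sup>2"
    unfolding m_def by (rule cSup_least[OF ne ub])
  also have "\<dots> < 0"
    using x nx by (simp add: divide_neg_pos)
  finally have m: "m < 0" .
  have mS: "m * (norm y)\<^sup>2 \<le> H y \<bullet> y" for y
  proof (cases "y = 0")
    case False
    have "m \<le> (H y \<bullet> y) / (norm y)\<^sup>2"
      unfolding m_def using False by (intro cSup_least[OF ne]) (simp add: S_def field_simps)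
    then show ?thesis
      using False by (simp add: field_simps)
  qed simp
  have "positive_op (H - m *\<^sub>R id_blinfun)"
    using sym mS by (auto simp: positive_op_def power2_norm_eq_inner
        blinfun.diff_left blinfun.scaleR_left inner_simps intro!: symmetric_op_intros)
  \<comment> \<open>Coercivity raises the lower bound \<open>m\<close> by \<open>\<delta>\<close>,
    against its maximality.\<close>
  then obtain \<delta> where \<delta>: "\<delta> > 0"
    "\<And>y. \<delta> * (norm y)\<^sup>2 \<le> (H - m *\<^sub>R id_blinfun) y \<bullet> y"
    using bb[OF m] positive_op_coercive_if_bounded_below by blast
  then have "m + \<delta> \<in> S"
    by (simp add: S_def power2_norm_eq_inner blinfun.diff_left blinfun.scaleR_left inner_simps
        algebra_simps)
  then have "m + \<delta> \<le> m"
    unfolding m_def using bdd by (rule cSup_upper)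
  with \<delta>(1) show False
    by simp
qed

text \<open>\<open>T (T x) = y\<close> is solved by the fixed point of
  \<open>x \<mapsto> x - \<tau> (T (T x) - y)\<close>, whose linear part \<open>L\<close> is a
  strict contraction because \<open>T\<close> is bounded below.\<close>

lemma symmetric_bounded_below_surj:
  fixes T :: "'b::{real_inner, complete_space} \<Rightarrow>\<^sub>L 'b"
  assumes sym: "symmetric_op T" and bb: "bounded_below T"
  shows "\<exists>x. T x = y"
proof (cases "T = 0")
  case True
  obtain c where c: "c > 0" "\<And>x. c * norm x \<le> norm (T x)"
    using bb unfolding bounded_below_def by blast
  from c(2)[of y] c(1) True have "y = 0"
    by (simp add: mult_le_0_iff)
  then show ?thesis
    using True by simp
next
  case False
  obtain c where c: "c > 0" "\<And>x. c * norm x \<le> norm (T x)"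
    using bb unfolding bounded_below_def by blast
  \<comment> \<open>This step size keeps the form of \<open>L\<close> nonnegative.\<close>
  define \<tau> where "\<tau> = 1 / (norm T)\<^sup>2"
  have \<tau>: "\<tau> > 0"
    using False by (simp add: \<tau>_def)
  define L where "L = id_blinfun - \<tau> *\<^sub>R (T o\<^sub>L T)"
  define k where "k = max 0 (1 - \<tau> * c\<^sup>2)"
  have k: "0 \<le> k" "k < 1"
    using \<tau> c(1) by (auto simp: k_def)
  have L: "symmetric_op L"
    using sym unfolding L_def by (intro symmetric_op_intros) (simp add: symmetric_op_def)
  have Lx: "L x \<bullet> x = (norm x)\<^sup>2 - \<tau> * (norm (T x))\<^sup>2" for x
    using symmetric_opD[OF sym, of "T x" x]
    by (simp add: L_def blinfun.diff_left blinfun.scaleR_left inner_simps power2_norm_eq_inner)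
  have "\<bar>L x \<bullet> x\<bar> \<le> k * (norm x)\<^sup>2" for x
  proof -
    have "(norm (T x))\<^sup>2 \<le> (norm T * norm x)\<^sup>2"
      by (intro power_mono norm_blinfun) auto
    then have 1: "\<tau> * (norm (T x))\<^sup>2 \<le> (norm x)\<^sup>2"
      using False by (simp add: \<tau>_def field_simps power_mult_distrib)
    have "(c * norm x)\<^sup>2 \<le> (norm (T x))\<^sup>2"
      using c by (intro power_mono) auto
    then have "\<tau> * (c * norm x)\<^sup>2 \<le> \<tau> * (norm (T x))\<^sup>2"
      using \<tau> by simp
    then have "L x \<bullet> x \<le> (1 - \<tau> * c\<^sup>2) * (norm x)\<^sup>2"
      by (simp add: Lx power_mult_distrib algebra_simps)
    also have "\<dots> \<le> k * (norm x)\<^sup>2"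
      by (intro mult_right_mono) (auto simp: k_def)
    finally show ?thesis
      using 1 by (simp add: Lx)
  qed
  then have nL: "norm L \<le> k"
    using norm_symmetric_op_le[OF L] k by blast
  have "dist (L u + \<tau> *\<^sub>R y) (L v + \<tau> *\<^sub>R y) \<le> k * dist u v" for u v
  proof -
    have "norm (L (u - v)) \<le> k * norm (u - v)"
      using norm_blinfun[of L "u - v"] mult_right_mono[OF nL, of "norm (u - v)"] by simp
    then show ?thesis
      by (simp add: dist_norm blinfun.diff_right)
  qed
  then obtain x where "L x + \<tau> *\<^sub>R y = x"
    using banach_fix_type[of k "\<lambda>x. L x + \<tau> *\<^sub>R y"] k by blast
  then have "\<tau> *\<^sub>R T (T x) = \<tau> *\<^sub>R y"
    by (auto simp: L_def blinfun.diff_left blinfun.scaleR_left)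
  then have "T (T x) = y"
    using \<tau> by simp
  then show ?thesis
    by blast
qed

text \<open>The minimiser of \<open>x \<bullet> x - 2 * f x\<close> represents \<open>f\<close>; minimising sequences are Cauchy by the
  parallelogram law.\<close>

lemma riesz_representation:
  fixes f :: "'b::{real_inner, complete_space} \<Rightarrow> real"
  assumes f: "bounded_linear f"
  obtains a where "\<And>x. f x = x \<bullet> a"
proof -
  interpret f: bounded_linear f by (fact f)
  define J where "J = (\<lambda>x. x \<bullet> x - 2 * f x)"
  obtain K where K: "\<And>x. norm (f x) \<le> norm x * K"
    using f.bounded by blast
  have lb: "- K\<^sup>2 \<le> J x" for x
  proof -
    have "0 \<le> (norm x - K)\<^sup>2"
      by simp
    then have "- K\<^sup>2 \<le> (norm x)\<^sup>2 - 2 * (norm x * K)"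
      by (simp add: power2_diff algebra_simps)
    then show ?thesis
      using K[of x] by (simp add: J_def power2_norm_eq_inner)
  qed
  define m where "m = Inf (range J)"
  have bdd: "bdd_below (range J)"
    using lb by (intro bdd_belowI) auto
  have m: "m \<le> J x" for x
    unfolding m_def by (intro cInf_lower bdd) auto
  have "\<exists>x. J x < m + 1 / Suc n" for n
    using cInf_lessD[of "range J" "m + 1 / Suc n"] by (auto simp: m_def)
  then obtain X where X: "\<And>n. J (X n) < m + 1 / Suc n"
    by metis
  have par: "(norm (x - y))\<^sup>2 = 2 * J x + 2 * J y - 4 * J ((1/2) *\<^sub>R (x + y))" for x y
    by (simp add: J_def power2_norm_eq_inner inner_simps f.add f.scaleR inner_commute algebra_simps)
  have "Cauchy X"
  proof (rule metric_CauchyI)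
    fix e :: real assume e: "e > 0"
    then obtain M where M: "1 / Suc M < e\<^sup>2 / 4"
      using nat_approx_posE[of "e\<^sup>2 / 4"] by auto
    have "dist (X i) (X j) < e" if "i \<ge> M" "j \<ge> M" for i j
    proof -
      have "1 / Suc i \<le> 1 / Suc M" "1 / Suc j \<le> 1 / Suc M"
        using that by (auto simp: frac_le)
      then have "(norm (X i - X j))\<^sup>2 < e\<^sup>2"
        using X[of i] X[of j] m[of "(1/2) *\<^sub>R (X i + X j)"] M
        unfolding par by linarith
      then show ?thesis
        using e by (simp add: dist_norm power_less_imp_less_base)
    qed
    then show "\<exists>M. \<forall>i\<ge>M. \<forall>j\<ge>M. dist (X i) (X j) < e"
      by blast
  qed
  then obtain a where a: "X \<longlonglongrightarrow> a"
    using Cauchy_convergent convergent_def by blast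
  have "(\<lambda>n. J (X n)) \<longlonglongrightarrow> J a"
    unfolding J_def by (intro tendsto_intros a f.tendsto)
  moreover have "(\<lambda>n. m + 1 / Suc n) \<longlonglongrightarrow> m + 0"
    by (intro tendsto_intros LIMSEQ_Suc lim_1_over_n)
  ultimately have Ja: "J a \<le> m"
    using X by (intro LIMSEQ_le[of "\<lambda>n. J (X n)" "J a"]) (auto intro: less_imp_le)
  have "f y = y \<bullet> a" for y
  proof (cases "y = 0")
    case False
    define b where "b = y \<bullet> a - f y"
    \<comment> \<open>The minimiser of the increment
      \<open>2 * t * b + t\<^sup>2 * (y \<bullet> y)\<close> of \<open>J\<close> along
      \<open>y\<close>; as \<open>a\<close> minimises \<open>J\<close>, this increment cannot be
      negative, so \<open>b = 0\<close>.\<close>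
    define t where "t = - b / (y \<bullet> y)"
    have y: "y \<bullet> y > 0"
      using False by simp
    have "J a \<le> J (a + t *\<^sub>R y)"
      using Ja m order_trans by blast
    then have "0 \<le> 2 * t * b + t\<^sup>2 * (y \<bullet> y)"
      by (simp add: J_def b_def inner_simps f.add f.scaleR inner_commute power2_eq_square
          algebra_simps)
    also have "\<dots> = - (b\<^sup>2 / (y \<bullet> y))"
      using y by (simp add: t_def field_simps power2_eq_square)
    finally have "b\<^sup>2 \<le> 0"
      using y by (simp add: field_simps)
    then show ?thesis
      by (simp add: b_def)
  qed simp
  then show ?thesis
    using that by blast
qed

subsection \<open>Adjoints and spectra\<close>

instance complex_hilbert_space \<subseteq> banach ..

lemma cinner_scaleC_right: "cinner x (c *\<^sub>C y) = cnj c * cinner x y"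
  by (metis cinner_commute cinner_scaleC_left complex_cnj_mult)

lemma inner_scaleC: "(c *\<^sub>C x) \<bullet> y = x \<bullet> (cnj c *\<^sub>C y)"
  by (simp add: cinner_scaleC_left cinner_scaleC_right flip: Re_cinner)

text \<open>Together with \<open>Re_cinner\<close> this recovers the complex inner product from the
  real one.\<close>

lemma Im_cinner: "Im (cinner x y) = ((- \<i>) *\<^sub>C x) \<bullet> y"
  by (simp add: cinner_scaleC_left flip: Re_cinner)

lemma inner_right_cancel: "(\<And>x. x \<bullet> a = x \<bullet> b) \<Longrightarrow> a = b"
  for a b :: "'b::real_inner"
  by (metis inner_commute vector_eq_rdot)

lemma bounded_operatorsD: "T \<in> bounded_operators \<Longrightarrow> T (c *\<^sub>C x) = c *\<^sub>C T x"
  by (simp add: bounded_operators_def)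

lemma bounded_operators_id: "id_blinfun \<in> bounded_operators"
  by (simp add: bounded_operators_def)

lemma bounded_operators_compose:
  "T \<in> bounded_operators \<Longrightarrow> U \<in> bounded_operators \<Longrightarrow> T o\<^sub>L U \<in> bounded_operators"
  by (simp add: bounded_operators_def)

lemma bounded_operators_add:
  "T \<in> bounded_operators \<Longrightarrow> U \<in> bounded_operators \<Longrightarrow> T + U \<in> bounded_operators"
  by (simp add: bounded_operators_def blinfun.add_left scaleC_add_right)

lemma scaleC_scaleR: "c *\<^sub>C (r *\<^sub>R x) = r *\<^sub>R (c *\<^sub>C x)"
  by (simp add: scaleC_scaleC mult.commute flip: scaleC_of_real)

lemma bounded_operators_scaleR:
  "T \<in> bounded_operators \<Longrightarrow> r *\<^sub>R T \<in> bounded_operators"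
  by (simp add: bounded_operators_def blinfun.scaleR_left scaleC_scaleR)

lemma bounded_operators_diff:
  assumes "T \<in> bounded_operators" "U \<in> bounded_operators"
  shows "T - U \<in> bounded_operators"
  using bounded_operators_add[OF assms(1) bounded_operators_scaleR[OF assms(2), of "-1"]] by simp

lemma bounded_operators_scalar_op: "scalar_op z \<in> bounded_operators"
  by (simp add: bounded_operators_def scalar_op.rep_eq scaleC_scaleC mult.commute)

lemma scalar_op_of_real: "scalar_op (complex_of_real t) = t *\<^sub>R id_blinfun"
  by (rule blinfun_eqI) (simp add: scalar_op.rep_eq scaleC_of_real blinfun.scaleR_left)

lemma bounded_operators_tendsto:
  assumes X: "\<And>n. X n \<in> bounded_operators" and lim: "X \<longlonglongrightarrow> A"
  shows "A \<in> bounded_operators"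
  unfolding bounded_operators_def
proof (intro CollectI allI)
  fix c x
  have "(\<lambda>n. X n (c *\<^sub>C x)) \<longlonglongrightarrow> A (c *\<^sub>C x)"
    by (intro tendsto_intros lim)
  moreover have "(\<lambda>n. scalar_op c (X n x)) \<longlonglongrightarrow> scalar_op c (A x)"
    by (intro tendsto_intros lim)
  ultimately show "A (c *\<^sub>C x) = c *\<^sub>C A x"
    using LIMSEQ_unique bounded_operatorsD[OF X] by (simp add: scalar_op.rep_eq)
qed

lemma symmetric_op_tendsto:
  assumes X: "\<And>n. symmetric_op (X n)" and lim: "X \<longlonglongrightarrow> A"
  shows "symmetric_op A"
  unfolding symmetric_op_def
proof (intro allI)
  fix x y
  have "(\<lambda>n. X n x \<bullet> y) \<longlonglongrightarrow> A x \<bullet> y" "(\<lambda>n. x \<bullet> X n y) \<longlonglongrightarrow> x \<bullet> A y"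
    by (intro tendsto_intros lim)+
  then show "A x \<bullet> y = x \<bullet> A y"
    using LIMSEQ_unique X by (simp add: symmetric_op_def)
qed

section \<open>Existence, uniqueness and complex linearity of adjoints\<close>

lemma ex_real_adjoint:
  fixes T :: "'b::{real_inner, complete_space} \<Rightarrow>\<^sub>L 'b"
  obtains A :: "'b \<Rightarrow>\<^sub>L 'b" where "\<And>x y. T x \<bullet> y = x \<bullet> A y"
proof -
  \<comment> \<open>The Riesz vector of this functional is the value of the adjoint at
    \<open>y\<close>; its uniqueness yields linearity in \<open>y\<close>.\<close>
  have "\<exists>a. \<forall>x. T x \<bullet> y = x \<bullet> a" for y
  proof -
    have "bounded_linear (\<lambda>x. T x \<bullet> y)"
      by (intro bounded_linear_intros)
    then show ?thesis
      by (metis riesz_representation)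
  qed
  then obtain a where a: "\<And>x y. T x \<bullet> y = x \<bullet> a y"
    by metis
  have "bounded_linear a"
  proof (rule bounded_linear_intro)
    show "a (x + y) = a x + a y" for x y
      by (rule inner_right_cancel) (simp add: inner_add_right flip: a)
    show "a (r *\<^sub>R x) = r *\<^sub>R a x" for r x
      by (rule inner_right_cancel) (simp flip: a)
    show "norm (a x) \<le> norm x * norm T" for x
    proof (cases "a x = 0")
      case False
      have "norm (a x) * norm (a x) = T (a x) \<bullet> x"
        by (simp add: a flip: power2_norm_eq_inner power2_eq_square)
      also have "\<dots> \<le> norm (T (a x)) * norm x"
        by (rule norm_cauchy_schwarz)
      also have "\<dots> \<le> norm T * norm (a x) * norm x"
        by (intro mult_right_mono norm_blinfun) auto
      finally have "norm (a x) * norm (a x) \<le> norm (a x) * (norm x * norm T)"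
        by (simp add: algebra_simps)
      then show ?thesis
        using False by simp
    qed simp
  qed
  then show ?thesis
    using a that[of "Blinfun a"] by (simp add: bounded_linear_Blinfun_apply)
qed

lemma real_adjoint_unique:
  assumes "\<And>x y. T x \<bullet> y = x \<bullet> blinfun_apply A y" "\<And>x y. T x \<bullet> y = x \<bullet> blinfun_apply B y"
  shows "A = B"
  by (rule blinfun_eqI, rule inner_right_cancel) (simp flip: assms)

text \<open>The imaginary part is the real part at \<open>(- \<i>) *\<^sub>C x\<close>, and
  \<open>T\<close> commutes with this scalar.\<close>

lemma cinner_real_adjoint:
  assumes T: "T \<in> bounded_operators" and A: "\<And>x y. T x \<bullet> y = x \<bullet> blinfun_apply A y"
  shows "cinner (T x) y = cinner x (A y)"
proof (rule complex_eqI)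
  show "Re (cinner (T x) y) = Re (cinner x (A y))"
    by (simp add: Re_cinner A)
  show "Im (cinner (T x) y) = Im (cinner x (A y))"
    by (simp add: Im_cinner A flip: bounded_operatorsD[OF T])
qed

lemma bounded_operators_real_adjoint:
  assumes T: "T \<in> bounded_operators" and A: "\<And>x y. T x \<bullet> y = x \<bullet> blinfun_apply A y"
  shows "A \<in> bounded_operators"
  unfolding bounded_operators_def
proof (intro CollectI allI, rule inner_right_cancel)
  fix c x y
  have "y \<bullet> A (c *\<^sub>C x) = (cnj c *\<^sub>C T y) \<bullet> x"
    by (simp add: inner_scaleC flip: A)
  also have "\<dots> = y \<bullet> (c *\<^sub>C A x)"
    by (simp add: A inner_scaleC flip: bounded_operatorsD[OF T])
  finally show "y \<bullet> A (c *\<^sub>C x) = y \<bullet> (c *\<^sub>C A x)" .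
qed

text \<open>Resolves the definite description in \<open>adj\<close>: the real adjoint is
  complex-linear, hence the complex one, and real parts already determine it.\<close>

lemma adj_eqI:
  assumes T: "T \<in> bounded_operators" and A: "\<And>x y. T x \<bullet> y = x \<bullet> blinfun_apply A y"
  shows "adj T = A"
  unfolding adj_def
proof (rule the_equality)
  show "A \<in> bounded_operators \<and> (\<forall>x y. cinner (T x) y = cinner x (A y))"
    using bounded_operators_real_adjoint[OF assms] cinner_real_adjoint[OF assms] by blast
  show "B = A" if "B \<in> bounded_operators \<and> (\<forall>x y. cinner (T x) y = cinner x (B y))" for B
    using that A by (intro real_adjoint_unique[of T]) (auto simp flip: Re_cinner)
qed

lemma adj_inner:
  assumes "T \<in> bounded_operators"
  shows "T x \<bullet> y = x \<bullet> adj T y"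
proof -
  obtain A :: "'a \<Rightarrow>\<^sub>L 'a" where A: "\<And>x y. T x \<bullet> y = x \<bullet> A y"
    using ex_real_adjoint by blast
  with adj_eqI[OF assms, of A] show ?thesis
    by simp
qed

lemma bounded_operators_adj: "T \<in> bounded_operators \<Longrightarrow> adj T \<in> bounded_operators"
  using bounded_operators_real_adjoint adj_inner by blast

lemma adj_adj: "T \<in> bounded_operators \<Longrightarrow> adj (adj T) = T"
  using adj_inner[of T] by (intro adj_eqI[OF bounded_operators_adj]) (simp_all add: inner_commute)

lemma positive_op_compose_adjoint:
  fixes X Y :: "'b::real_inner \<Rightarrow>\<^sub>L 'b"
  assumes "\<And>u v. X v \<bullet> u = v \<bullet> Y u"
  shows "positive_op (Y o\<^sub>L X)"
proof -
  have *: "Y u \<bullet> v = u \<bullet> X v" for u v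
    using assms[of v u] by (simp add: inner_commute)
  have "Y (X u) \<bullet> v = u \<bullet> Y (X v)" for u v
    by (simp only: * assms)
  moreover have "0 \<le> Y (X u) \<bullet> u" for u
    unfolding * by (rule inner_ge_zero)
  ultimately show ?thesis
    by (simp add: positive_op_def symmetric_op_def)
qed

lemma norm_adj_le: "T \<in> bounded_operators \<Longrightarrow> norm (adj T) \<le> norm T"
proof (rule norm_blinfun_bound)
  fix x assume T: "T \<in> bounded_operators"
  have "norm (adj T x) * norm (adj T x) = T (adj T x) \<bullet> x"
    by (simp add: adj_inner[OF T] flip: power2_norm_eq_inner power2_eq_square)
  also have "\<dots> \<le> norm (T (adj T x)) * norm x"
    by (rule norm_cauchy_schwarz)
  also have "\<dots> \<le> norm T * norm (adj T x) * norm x"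
    by (intro mult_right_mono norm_blinfun) auto
  finally have "norm (adj T x) * norm (adj T x) \<le> norm (adj T x) * (norm T * norm x)"
    by (simp add: algebra_simps)
  then show "norm (adj T x) \<le> norm T * norm x"
    by (cases "adj T x = 0") auto
qed simp

section \<open>Spectra of bounded and of symmetric operators\<close>

lemma not_in_spectrumI:
  assumes T: "T \<in> bounded_operators" and bb: "bounded_below (T - scalar_op z)"
    and surj: "\<And>y. \<exists>x. (T - scalar_op z) x = y"
  shows "z \<notin> spectrum T"
proof -
  define U where "U = T - scalar_op z"
  obtain c where c: "c > 0" "\<And>x. c * norm x \<le> norm (U x)"
    using bb unfolding bounded_below_def U_def by blast
  \<comment> \<open>A right inverse by choice; injectivity of \<open>U\<close> makes it two-sided
    and complex-linear, and the constant \<open>c\<close> makes it bounded.\<close>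
  obtain g where g: "\<And>y. U (g y) = y"
    using surj unfolding U_def by metis
  have inj: "x = y" if "U x = U y" for x y
    using c(2)[of "x - y"] c(1) that by (simp add: blinfun.diff_right mult_le_0_iff)
  have U: "U \<in> bounded_operators"
    unfolding U_def by (intro bounded_operators_diff T bounded_operators_scalar_op)
  have "bounded_linear g"
  proof (rule bounded_linear_intro)
    show "g (x + y) = g x + g y" for x y
      by (rule inj) (simp add: g blinfun.add_right)
    show "g (r *\<^sub>R x) = r *\<^sub>R g x" for r x
      by (rule inj) (simp add: g blinfun.scaleR_right)
    show "norm (g x) \<le> norm x * (1 / c)" for x
      using c(2)[of "g x"] c(1) by (simp add: g field_simps)
  qed
  then have R: "blinfun_apply (Blinfun g) = g"
    by (rule bounded_linear_Blinfun_apply)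
  have gU: "g (U x) = x" for x
    by (rule inj) (simp add: g)
  have "g (c *\<^sub>C x) = c *\<^sub>C g x" for c x
    by (rule inj) (simp add: g bounded_operatorsD[OF U])
  then have "Blinfun g \<in> bounded_operators"
    by (simp add: bounded_operators_def R)
  moreover have "Blinfun g o\<^sub>L U = id_blinfun" "U o\<^sub>L Blinfun g = id_blinfun"
    by (rule blinfun_eqI, simp add: R g gU)+
  ultimately show ?thesis
    unfolding spectrum_def U_def by blast
qed

text \<open>Symmetric bounded-below operators are onto, which gives an inverse; conversely, a left
  inverse makes an operator bounded below.\<close>

lemma of_real_in_spectrum_iff:
  assumes T: "T \<in> bounded_operators" "symmetric_op T"
  shows "complex_of_real t \<in> spectrum T \<longleftrightarrow> \<not> bounded_below (T - t *\<^sub>R id_blinfun)"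
proof
  assume "complex_of_real t \<in> spectrum T"
  moreover have "\<exists>x. (T - t *\<^sub>R id_blinfun) x = y" if "bounded_below (T - t *\<^sub>R id_blinfun)" for y
    using T(2) that by (intro symmetric_bounded_below_surj) (intro symmetric_op_intros)
  ultimately show "\<not> bounded_below (T - t *\<^sub>R id_blinfun)"
    using not_in_spectrumI[OF T(1), of "complex_of_real t"] by (auto simp: scalar_op_of_real)
next
  assume nb: "\<not> bounded_below (T - t *\<^sub>R id_blinfun)"
  have "bounded_below (id_blinfun :: 'a \<Rightarrow>\<^sub>L 'a)"
    unfolding bounded_below_def by (intro exI[of _ 1]) simp
  then have "R o\<^sub>L (T - t *\<^sub>R id_blinfun) \<noteq> id_blinfun" for R :: "'a \<Rightarrow>\<^sub>L 'a"
    using nb bounded_below_right_factor by metis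
  then show "complex_of_real t \<in> spectrum T"
    by (simp add: spectrum_def scalar_op_of_real)
qed

text \<open>If \<open>cmod z > norm T\<close>, the triangle inequality bounds \<open>T - z\<close>
  below, and \<open>T x - z x = y\<close> is a fixed point equation for a contraction. Symmetry is
  not assumed, since \<open>norm_le_spectral_radius\<close> applies this to a product.\<close>

lemma cmod_le_norm_if_in_spectrum:
  assumes T: "T \<in> bounded_operators" and z: "z \<in> spectrum T"
  shows "cmod z \<le> norm T"
proof (rule ccontr)
  assume "\<not> cmod z \<le> norm T"
  then have lt: "norm T < cmod z" "0 < cmod z" "z \<noteq> 0"
    by (auto simp: not_le intro: le_less_trans[OF norm_ge_zero])
  have "bounded_below (T - scalar_op z)"
    unfolding bounded_below_def
  proof (intro exI[of _ "cmod z - norm T"] conjI allI)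
    fix x
    have "cmod z * norm x \<le> norm (T x) + norm (T x - z *\<^sub>C x)"
      by (metis norm_scaleC norm_triangle_sub norm_minus_commute)
    then show "(cmod z - norm T) * norm x \<le> norm ((T - scalar_op z) x)"
      using norm_blinfun[of T x] by (simp add: blinfun.diff_left scalar_op.rep_eq algebra_simps)
  qed (use lt in simp)
  moreover have "\<exists>x. (T - scalar_op z) x = y" for y
  proof -
    have "\<exists>!x. inverse z *\<^sub>C (T x - y) = x"
    proof (rule banach_fix_type[of "norm T / cmod z"]; (intro allI)?)
      fix u v
      have "inverse z *\<^sub>C (T u - y) - inverse z *\<^sub>C (T v - y) = inverse z *\<^sub>C T (u - v)"
        using scaleC_add_right[of "inverse z" "T (u - v)" "T v - y"]
        by (simp add: blinfun.diff_right)
      then have "dist (inverse z *\<^sub>C (T u - y)) (inverse z *\<^sub>C (T v - y)) = norm (T (u - v)) / cmod z"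
        by (simp add: dist_norm norm_scaleC norm_inverse divide_inverse mult.commute)
      also have "\<dots> \<le> norm T * norm (u - v) / cmod z"
        by (intro divide_right_mono norm_blinfun) auto
      finally show "dist (inverse z *\<^sub>C (T u - y)) (inverse z *\<^sub>C (T v - y))
          \<le> norm T / cmod z * dist u v"
        by (simp add: dist_norm)
    qed (use lt in auto)
    then obtain x where "inverse z *\<^sub>C (T x - y) = x"
      by blast
    then have "z *\<^sub>C x = (z * inverse z) *\<^sub>C (T x - y)"
      by (metis scaleC_scaleC)
    also have "\<dots> = T x - y"
      using lt(3) scaleC_of_real[of 1 "T x - y"] by simp
    finally show ?thesis
      by (intro exI[of _ x]) (simp add: blinfun.diff_left scalar_op.rep_eq)
  qed
  ultimately show False
    using not_in_spectrumI[OF T] z by blast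
qed

subsection \<open>Polynomials of a symmetric operator\<close>

lemma poly_op_eq_sum:
  assumes "degree p \<le> n"
  shows "poly_op p T = (\<Sum>i\<le>n. coeff p i *\<^sub>R ((\<lambda>A. T o\<^sub>L A) ^^ i) id_blinfun)"
  unfolding poly_op_def using assms
  by (intro sum.mono_neutral_left) (auto simp: coeff_eq_0)

lemma poly_op_0 [simp]: "poly_op 0 T = 0"
  by (simp add: poly_op_def)

lemma poly_op_pCons: "poly_op (pCons a p) T = a *\<^sub>R id_blinfun + (T o\<^sub>L poly_op p T)"
proof -
  \<comment> \<open>Only an inequality: for \<open>p = 0\<close> both degrees are 0, so the sum is
    padded with a zero coefficient.\<close>
  have "degree (pCons a p) \<le> Suc (degree p)"
    by (rule degree_pCons_le)
  from poly_op_eq_sum[OF this, of T] show ?thesis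
    unfolding sum.atMost_Suc_shift poly_op_def
    by (intro blinfun_eqI)
      (simp add: blinfun.add_left blinfun.scaleR_left blinfun.sum_left blinfun.sum_right
        blinfun.scaleR_right)
qed

lemma poly_op_add: "poly_op (p + q) T = poly_op p T + poly_op q T"
  by (induction p q rule: poly_induct2)
    (auto simp: poly_op_pCons blinfun.bilinear_simps scaleR_add_left intro!: blinfun_eqI)

lemma poly_op_smult: "poly_op (smult c p) T = c *\<^sub>R poly_op p T"
  by (induction p)
    (auto simp: poly_op_pCons blinfun.bilinear_simps scaleR_add_right intro!: blinfun_eqI)

lemma poly_op_diff: "poly_op (p - q) T = poly_op p T - poly_op q T"
  using poly_op_add[of p "smult (-1) q" T] unfolding poly_op_smult by simp

lemma poly_op_const: "poly_op [:c:] T = c *\<^sub>R id_blinfun"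
  by (rule blinfun_eqI) (simp add: poly_op_pCons blinfun.bilinear_simps)

lemma poly_op_mult: "poly_op (p * q) T = poly_op p T o\<^sub>L poly_op q T"
  by (induction p)
    (auto simp: poly_op_pCons poly_op_add poly_op_smult blinfun.bilinear_simps intro!: blinfun_eqI)

lemma poly_op_linear: "poly_op [:b, a:] T = b *\<^sub>R id_blinfun + a *\<^sub>R T"
  by (rule blinfun_eqI) (simp add: poly_op_pCons blinfun.bilinear_simps)

text \<open>Allowing two operators prepares \<open>sqrt_op_intertwine\<close>; with \<open>X\<close>
  and \<open>U\<close> equal to \<open>T\<close> it says that \<open>T\<close> commutes with its
  polynomials.\<close>

lemma poly_op_intertwine:
  assumes "X o\<^sub>L T = U o\<^sub>L X"
  shows "X o\<^sub>L poly_op p T = poly_op p U o\<^sub>L X"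
proof (induction p)
  case (pCons a p)
  have 1: "X (T x) = U (X x)" for x
    using arg_cong[OF assms, of "\<lambda>F. blinfun_apply F x"] by simp
  have 2: "X (poly_op p T x) = poly_op p U (X x)" for x
    using arg_cong[OF pCons.IH, of "\<lambda>F. blinfun_apply F x"] by simp
  show ?case
    by (rule blinfun_eqI) (simp add: poly_op_pCons blinfun.bilinear_simps 1 2)
qed simp

lemma bounded_operators_poly_op:
  "T \<in> bounded_operators \<Longrightarrow> poly_op p T \<in> bounded_operators"
  by (induction p) (auto simp: poly_op_pCons scaleC_of_real[of 0, simplified]
      intro!: bounded_operators_add bounded_operators_scaleR
      bounded_operators_compose bounded_operators_id bounded_operators_scaleR[of _ 0, simplified])

lemma symmetric_op_poly_op:
  assumes "symmetric_op T"
  shows "symmetric_op (poly_op p T)"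
proof (induction p)
  case (pCons a p)
  have "T (poly_op p T x) = poly_op p T (T x)" for x
    using arg_cong[OF poly_op_intertwine[of T T T p, OF refl], of "\<lambda>F. blinfun_apply F x"] by simp
  then have "symmetric_op (T o\<^sub>L poly_op p T)"
    using assms pCons.IH by (simp add: symmetric_op_def)
  then show ?case
    unfolding poly_op_pCons by (intro symmetric_op_intros)
qed (simp add: symmetric_op_def)

section \<open>Factorisation of real polynomials\<close>

lemma map_poly_of_real_add:
  "map_poly complex_of_real (p + q) = map_poly complex_of_real p + map_poly complex_of_real q"
  by (rule poly_eqI) (simp add: coeff_map_poly)

lemma map_poly_of_real_mult:
  "map_poly complex_of_real (p * q) = map_poly complex_of_real p * map_poly complex_of_real q"
  by (rule poly_eqI) (simp add: coeff_map_poly coeff_mult)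

lemma poly_map_poly_of_real:
  "poly (map_poly complex_of_real p) (complex_of_real t) = complex_of_real (poly p t)"
  by (induction p) (simp_all add: map_poly_pCons)

text \<open>A complex root \<open>a + b i\<close> yields a linear factor if it is real, otherwise
  the real quadratic with roots \<open>a \<pm> b i\<close>.\<close>

lemma real_poly_factor:
  fixes p :: "real poly"
  assumes "degree p > 0"
  obtains (linear) t q where "p = [:- t, 1:] * q"
  | (quadratic) a b q where "b \<noteq> 0" "p = ([:- a, 1:]\<^sup>2 + [:b\<^sup>2:]) * q"
proof -
  define c where "c = map_poly complex_of_real"
  have "\<not> constant (poly (c p))"
    using assms by (simp add: c_def constant_degree degree_map_poly)
  then obtain z where z: "poly (c p) z = 0"
    using fundamental_theorem_of_algebra by blast
  define a b where "a = Re z" and "b = Im z"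
  have zab: "z = Complex a b"
    by (simp add: a_def b_def)
  define s where "s = [:a\<^sup>2 + b\<^sup>2, - 2 * a, 1:]"
  have s: "s = [:- a, 1:]\<^sup>2 + [:b\<^sup>2:]"
    by (simp add: s_def power2_eq_square)
  have cs: "poly (c s) z = 0"
    by (simp add: c_def s_def zab map_poly_pCons complex_eq_iff power2_eq_square algebra_simps)
  show ?thesis
  proof (cases "b = 0")
    case True
    then have "z = complex_of_real a"
      by (simp add: zab complex_of_real_def)
    then have "poly p a = 0"
      using z by (simp add: c_def poly_map_poly_of_real)
    then have "[:- a, 1:] dvd p"
      by (simp add: poly_eq_0_iff_dvd)
    then show ?thesis
      using linear by (auto elim: dvdE)
  next
    case False
    \<comment> \<open>The remainder has degree at most 1 and vanishes at the nonreal point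
      \<open>z\<close>, so both of its real coefficients are zero.\<close>
    define r where "r = p mod s"
    have "degree s = 2" "s \<noteq> 0"
      by (simp_all add: s_def)
    then have "degree r \<le> 1"
      using degree_mod_less'[of s p] by (cases "r = 0") (auto simp: r_def)
    obtain r0 q where q: "r = pCons r0 q"
      by (rule pCons_cases)
    then obtain r1 where r: "r = [:r0, r1:]"
      using \<open>degree r \<le> 1\<close> by (cases "q = 0") (auto elim: degree_eq_zeroE)
    have "p = p div s * s + r"
      by (simp add: r_def)
    then have "poly (c p) z = poly (c (p div s)) z * poly (c s) z + poly (c r) z"
      by (metis c_def map_poly_of_real_add map_poly_of_real_mult poly_add poly_mult)
    then have "poly (c r) z = 0"
      using z cs by simp
    then have "complex_of_real r0 + z * complex_of_real r1 = 0"
      by (simp add: c_def r map_poly_pCons)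
    then have "r1 = 0" "r0 = 0"
      using False by (auto simp: zab complex_eq_iff)
    then have "p = s * (p div s)"
      using \<open>p = p div s * s + r\<close> by (simp add: r mult.commute)
    then show ?thesis
      using quadratic[OF False] s by simp
  qed
qed

text \<open>Induction on the degree, splitting off one factor; zeros of the cofactor are zeros of
  \<open>p\<close>.\<close>

lemma bounded_below_poly_op:
  fixes T :: "'a::complex_hilbert_space \<Rightarrow>\<^sub>L 'a"
  assumes sym: "symmetric_op T"
    and "\<And>t. poly p t = 0 \<Longrightarrow> bounded_below (T - t *\<^sub>R id_blinfun)"
  shows "bounded_below (poly_op p T)"
  using assms(2)
proof (induction "degree p" arbitrary: p rule: less_induct)
  case less
  show ?case
  proof (cases "degree p > 0")
    case False
    then obtain c where c: "p = [:c:]"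
      by (metis degree_eq_zeroE gr0I)
    show ?thesis
    proof (cases "c = 0")
      case False
      then show ?thesis
        by (intro bounded_below_if_coercive[of "\<bar>c\<bar>"])
          (auto simp: c poly_op_const blinfun.scaleR_left power2_norm_eq_inner abs_mult)
    next
      case True
      \<comment> \<open>For the zero polynomial the hypothesis covers every real \<open>t\<close>.
        Then the form of \<open>T\<close> lies above \<open>norm T + 1\<close>, so the space is
        trivial.\<close>
      define s where "s = norm T + 1"
      have "positive_op (T - s *\<^sub>R id_blinfun)"
      proof (rule positive_op_if_bounded_below)
        show "symmetric_op (T - s *\<^sub>R id_blinfun)"
          by (intro symmetric_op_intros sym)
        show "bounded_below (T - s *\<^sub>R id_blinfun - t *\<^sub>R id_blinfun)" for t
          using less.prems[of "s + t"] by (simp add: c True scaleR_add_left diff_diff_eq)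
      qed
      then have "s * (norm x)\<^sup>2 \<le> T x \<bullet> x" for x :: 'a
        by (simp add: positive_op_def blinfun.bilinear_simps inner_simps power2_norm_eq_inner)
      then have "s * (norm x)\<^sup>2 \<le> norm T * (norm x)\<^sup>2" for x :: 'a
        using blinfun_inner_bound[of T x] by (smt (verit))
      then have "x = 0" for x :: 'a
        by (simp add: s_def algebra_simps)
      then show ?thesis
        unfolding bounded_below_def by (metis norm_zero mult_zero_right norm_ge_zero zero_less_one)
    qed
  next
    case True
    then show ?thesis
    proof (cases rule: real_poly_factor)
      case (linear t q)
      then have "q \<noteq> 0"
        using True by auto
      then have "degree q < degree p"
        unfolding linear by (subst degree_mult_eq) auto
      then have "bounded_below (poly_op q T)"
        using less.hyps[of q] less.prems by (simp add: linear)
      moreover have "bounded_below (T - t *\<^sub>R id_blinfun)"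
        using less.prems[of t] by (simp add: linear)
      moreover have "poly_op p T = (T - t *\<^sub>R id_blinfun) o\<^sub>L poly_op q T"
        unfolding linear poly_op_mult poly_op_linear by simp
      ultimately show ?thesis
        using bounded_below_compose by simp
    next
      case (quadratic a b q)
      then have q: "q \<noteq> 0"
        using True by auto
      define s where "s = [:- a, 1:]\<^sup>2 + [:b\<^sup>2:]"
      have ds: "degree s = 2"
        by (simp add: s_def power2_eq_square)
      then have "degree q < degree p"
        using q unfolding quadratic s_def[symmetric] by (subst degree_mult_eq) auto
      then have "bounded_below (poly_op q T)"
        using less.hyps[of q] less.prems by (simp add: quadratic)
      \<comment> \<open>At \<open>T\<close> this factor is
        \<open>(T - a)\<^sup>2 + b\<^sup>2\<close>, and the form of the square is a squared
        norm.\<close>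
      moreover have "bounded_below (poly_op s T)"
      proof (rule bounded_below_if_coercive)
        show "b\<^sup>2 > 0"
          using quadratic by simp
        fix x
        let ?A = "T - a *\<^sub>R id_blinfun"
        have A: "symmetric_op ?A"
          by (intro symmetric_op_intros sym)
        have "poly_op s T = (?A o\<^sub>L ?A) + b\<^sup>2 *\<^sub>R id_blinfun"
          by (simp add: s_def power2_eq_square poly_op_add poly_op_mult poly_op_linear poly_op_const
              del: mult_pCons_left mult_pCons_right)
        then have "poly_op s T x \<bullet> x = ?A (?A x) \<bullet> x + b\<^sup>2 * (x \<bullet> x)"
          by (simp add: blinfun.add_left blinfun.scaleR_left inner_simps)
        also have "\<dots> = (norm (?A x))\<^sup>2 + b\<^sup>2 * (norm x)\<^sup>2"
          unfolding symmetric_opD[OF A, of "?A x"] by (simp only: power2_norm_eq_inner)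
        finally show "b\<^sup>2 * (norm x)\<^sup>2 \<le> \<bar>poly_op s T x \<bullet> x\<bar>"
          using zero_le_power2[of "norm (?A x)"] by linarith
      qed
      ultimately show ?thesis
        using bounded_below_compose by (simp add: quadratic s_def[symmetric] poly_op_mult)
    qed
  qed
qed

text \<open>If \<open>q \<le> M\<close> on the spectrum, then \<open>M - q - t\<close> has no zero
  there for \<open>t < 0\<close>, so \<open>M - q(T)\<close> is positive. Taking \<open>p\<close>
  and \<open>- p\<close> for \<open>q\<close> bounds the form of \<open>p(T)\<close>.\<close>

lemma norm_poly_op_le:
  fixes T :: "'a::complex_hilbert_space \<Rightarrow>\<^sub>L 'a"
  assumes T: "T \<in> bounded_operators" "symmetric_op T" and M: "M \<ge> 0"
    and p: "\<And>t. complex_of_real t \<in> spectrum T \<Longrightarrow> \<bar>poly p t\<bar> \<le> M"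
  shows "norm (poly_op p T) \<le> M"
proof -
  have *: "poly_op q T x \<bullet> x \<le> M * (norm x)\<^sup>2"
    if q: "\<And>t. complex_of_real t \<in> spectrum T \<Longrightarrow> poly q t \<le> M" for q x
  proof -
    have "positive_op (poly_op ([:M:] - q) T)"
    proof (rule positive_op_if_bounded_below)
      show "symmetric_op (poly_op ([:M:] - q) T)"
        by (intro symmetric_op_poly_op T)
      fix t :: real assume "t < 0"
      then have "bounded_below (poly_op ([:M:] - q - [:t:]) T)"
        using q of_real_in_spectrum_iff[OF T] by (intro bounded_below_poly_op T) fastforce
      then show "bounded_below (poly_op ([:M:] - q) T - t *\<^sub>R id_blinfun)"
        by (simp add: poly_op_diff poly_op_const)
    qed
    then show ?thesis
      by (simp add: positive_op_def poly_op_diff poly_op_const blinfun.bilinear_simps inner_simps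
          power2_norm_eq_inner)
  qed
  show ?thesis
  proof (rule norm_symmetric_op_le)
    fix x
    have "poly_op p T x \<bullet> x \<le> M * (norm x)\<^sup>2"
      using p by (intro *) fastforce
    moreover have "poly_op (smult (-1) p) T x \<bullet> x \<le> M * (norm x)\<^sup>2"
      using p by (intro *) fastforce
    ultimately show "\<bar>poly_op p T x \<bullet> x\<bar> \<le> M * (norm x)\<^sup>2"
      unfolding poly_op_smult by (simp add: blinfun.minus_left)
  qed (intro symmetric_op_poly_op T, fact M)
qed

subsection \<open>Functional calculus and square roots\<close>

lemma ex_poly_uniform_limit:
  fixes f :: "real \<Rightarrow> real"
  assumes "compact S" "continuous_on S f"
  obtains p :: "nat \<Rightarrow> real poly" where "uniform_limit S (\<lambda>n. poly (p n)) f sequentially"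
proof -
  have "\<exists>p. \<forall>x\<in>S. \<bar>f x - poly p x\<bar> < 1 / Suc n" for n
  proof -
    obtain g where g: "real_polynomial_function g" "\<And>x. x \<in> S \<Longrightarrow> \<bar>f x - g x\<bar> < 1 / Suc n"
      using Stone_Weierstrass_real_polynomial_function[OF assms, of "1 / Suc n"] by auto
    obtain a N where "g = (\<lambda>x. \<Sum>i\<le>N. a i * x ^ i)"
      using g(1) real_polynomial_function_iff_sum by blast
    then have "poly (\<Sum>i\<le>(N::nat). monom (a i) i) x = g x" for x
      by (simp add: poly_sum poly_monom)
    then show ?thesis
      using g(2) by metis
  qed
  then obtain p where p: "\<And>n x. x \<in> S \<Longrightarrow> \<bar>f x - poly (p n) x\<bar> < 1 / Suc n"
    by metis
  have "uniform_limit S (\<lambda>n. poly (p n)) f sequentially"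
    unfolding uniform_limit_sequentially_iff
  proof (intro allI impI)
    fix e :: real assume "e > 0"
    then obtain N where N: "1 / Suc N < e"
      using nat_approx_posE by blast
    have "dist (poly (p n) x) (f x) < e" if "n \<ge> N" "x \<in> S" for n x
    proof -
      have "1 / Suc n \<le> 1 / Suc N"
        using that by (simp add: frac_le)
      then show ?thesis
        using p[OF that(2), of n] N by (simp add: dist_real_def abs_minus_commute)
    qed
    then show "\<exists>N. \<forall>n\<ge>N. \<forall>x\<in>S. dist (poly (p n) x) (f x) < e"
      by blast
  qed
  then show ?thesis
    using that by blast
qed

lemma positive_op_spectrum_subset:
  assumes T: "T \<in> bounded_operators" "positive_op T"
  shows "{t. complex_of_real t \<in> spectrum T} \<subseteq> {0..norm T}"
proof
  fix t assume "t \<in> {t. complex_of_real t \<in> spectrum T}"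
  then have t: "complex_of_real t \<in> spectrum T"
    by simp
  have "t \<ge> 0"
  proof (rule ccontr)
    assume "\<not> t \<ge> 0"
    then have "bounded_below (T - t *\<^sub>R id_blinfun)"
      using T(2) by (intro bounded_below_if_coercive[of "- t"])
        (auto simp: positive_op_def blinfun.bilinear_simps inner_simps power2_norm_eq_inner
          intro!: order_trans[OF _ abs_ge_self])
    then show False
      using of_real_in_spectrum_iff[OF T(1)] T(2) t by (auto simp: positive_op_def)
  qed
  then show "t \<in> {0..norm T}"
    using cmod_le_norm_if_in_spectrum[OF T(1) t] by simp
qed

text \<open>Comparing two sequences serves two ends: \<open>q = p\<close> gives the Cauchy property,
  different sequences give independence of the limit.\<close>

lemma poly_op_eventually_close:
  fixes T :: "'a::complex_hilbert_space \<Rightarrow>\<^sub>L 'a"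
  assumes T: "T \<in> bounded_operators" "symmetric_op T"
    and p: "uniform_limit {t. complex_of_real t \<in> spectrum T} (\<lambda>n. poly (p n)) f sequentially"
    and q: "uniform_limit {t. complex_of_real t \<in> spectrum T} (\<lambda>n. poly (q n)) f sequentially"
    and e: "e > 0"
  shows "\<exists>N. \<forall>n\<ge>N. \<forall>m\<ge>N. dist (poly_op (p n) T) (poly_op (q m) T) < e"
proof -
  obtain N1 where N1: "\<And>n t. n \<ge> N1 \<Longrightarrow> complex_of_real t \<in> spectrum T \<Longrightarrow> \<bar>poly (p n) t - f t\<bar> < e / 4"
    using p e unfolding uniform_limit_sequentially_iff dist_real_def
    by (metis (no_types, lifting) mem_Collect_eq zero_less_divide_iff zero_less_numeral)
  obtain N2 where N2: "\<And>n t. n \<ge> N2 \<Longrightarrow> complex_of_real t \<in> spectrum T \<Longrightarrow> \<bar>poly (q n) t - f t\<bar> < e / 4"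
    using q e unfolding uniform_limit_sequentially_iff dist_real_def
    by (metis (no_types, lifting) mem_Collect_eq zero_less_divide_iff zero_less_numeral)
  have "dist (poly_op (p n) T) (poly_op (q m) T) < e" if "n \<ge> max N1 N2" "m \<ge> max N1 N2" for n m
  proof -
    have "norm (poly_op (p n - q m) T) \<le> e / 2"
    proof (rule norm_poly_op_le[OF T])
      fix t assume "complex_of_real t \<in> spectrum T"
      then have "\<bar>poly (p n) t - f t\<bar> < e / 4" "\<bar>poly (q m) t - f t\<bar> < e / 4"
        using N1[of n t] N2[of m t] that by auto
      then show "\<bar>poly (p n - q m) t\<bar> \<le> e / 2"
        unfolding poly_diff by linarith
    qed (use e in simp)
    then show ?thesis
      using e by (simp add: dist_norm poly_op_diff)
  qed
  then show ?thesis
    by blast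
qed

text \<open>Resolves the definite description in \<open>cfc\<close>: the sequence \<open>p\<close>
  has a limit by completeness, and every candidate must be the limit along \<open>p\<close>.\<close>

lemma poly_op_tendsto_cfc:
  fixes T :: "'a::complex_hilbert_space \<Rightarrow>\<^sub>L 'a"
  assumes T: "T \<in> bounded_operators" "symmetric_op T"
    and p: "uniform_limit {t. complex_of_real t \<in> spectrum T} (\<lambda>n. poly (p n)) f sequentially"
  shows "(\<lambda>n. poly_op (p n) T) \<longlonglongrightarrow> cfc f T"
proof -
  have "Cauchy (\<lambda>n. poly_op (p n) T)"
    using poly_op_eventually_close[OF T p p] by (intro metric_CauchyI) blast
  then obtain A where A: "(\<lambda>n. poly_op (p n) T) \<longlonglongrightarrow> A"
    using Cauchy_convergent convergent_def by blast
  have "cfc f T = A"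
    unfolding cfc_def
  proof (rule the_equality)
    show "\<forall>q :: nat \<Rightarrow> real poly.
        uniform_limit {t. complex_of_real t \<in> spectrum T} (\<lambda>n. poly (q n)) f sequentially \<longrightarrow>
        (\<lambda>n. poly_op (q n) T) \<longlonglongrightarrow> A"
    proof (intro allI impI)
      fix q :: "nat \<Rightarrow> real poly"
      assume q: "uniform_limit {t. complex_of_real t \<in> spectrum T} (\<lambda>n. poly (q n)) f sequentially"
      have "(\<lambda>n. poly_op (p n) T - poly_op (q n) T) \<longlonglongrightarrow> 0"
      proof (rule metric_LIMSEQ_I)
        fix e :: real assume "e > 0"
        then show "\<exists>N. \<forall>n\<ge>N. dist (poly_op (p n) T - poly_op (q n) T) 0 < e"
          using poly_op_eventually_close[OF T p q, of e] by (auto simp: dist_norm)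
      qed
      from tendsto_diff[OF A this] show "(\<lambda>n. poly_op (q n) T) \<longlonglongrightarrow> A"
        by simp
    qed
    show "B = A" if "\<forall>q :: nat \<Rightarrow> real poly.
        uniform_limit {t. complex_of_real t \<in> spectrum T} (\<lambda>n. poly (q n)) f sequentially \<longrightarrow>
        (\<lambda>n. poly_op (q n) T) \<longlonglongrightarrow> B" for B
      using that p A LIMSEQ_unique by blast
  qed
  then show ?thesis
    using A by simp
qed

text \<open>Approximation on an interval containing the spectrum lets one sequence serve two
  operators. On the nonnegative spectrum \<open>sqrt\<close> agrees with
  \<open>t powr (1/2)\<close>.\<close>

lemma poly_op_tendsto_sqrt:
  fixes T :: "'a::complex_hilbert_space \<Rightarrow>\<^sub>L 'a"
  assumes T: "T \<in> bounded_operators" "positive_op T" and M: "norm T \<le> M"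
    and p: "uniform_limit {0..M} (\<lambda>n. poly (p n)) sqrt sequentially"
  shows "(\<lambda>n. poly_op (p n) T) \<longlonglongrightarrow> powr_op T (1/2)"
  unfolding powr_op_def
proof (rule poly_op_tendsto_cfc)
  have sub: "{t. complex_of_real t \<in> spectrum T} \<subseteq> {0..M}"
    using positive_op_spectrum_subset[OF T] M by fastforce
  then have "uniform_limit {t. complex_of_real t \<in> spectrum T} (\<lambda>n. poly (p n)) sqrt sequentially"
    by (rule uniform_limit_on_subset[OF p])
  then show "uniform_limit {t. complex_of_real t \<in> spectrum T} (\<lambda>n. poly (p n))
      (\<lambda>t. t powr (1/2)) sequentially"
    using sub by (subst uniform_limit_cong'[of _ _ "\<lambda>n. poly (p n)" _ sqrt])
      (auto simp: powr_half_sqrt)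
qed (use T in \<open>auto simp: positive_op_def\<close>)

text \<open>Approximants of the fourth root tend to a symmetric \<open>R\<close>, and
  \<open>R o\<^sub>L R\<close> is the square root, hence positive. The fourth powers of the
  approximants tend to the identity function.\<close>

lemma sqrt_op:
  fixes T :: "'a::complex_hilbert_space \<Rightarrow>\<^sub>L 'a"
  assumes T: "T \<in> bounded_operators" "positive_op T"
  shows bounded_operators_sqrt_op: "powr_op T (1/2) \<in> bounded_operators"
    and positive_sqrt_op: "positive_op (powr_op T (1/2))"
    and sqrt_op_square: "powr_op T (1/2) o\<^sub>L powr_op T (1/2) = T"
proof -
  let ?I = "{0..norm T}" and ?P = "powr_op T (1/2)"
  have sym: "symmetric_op T"
    using T(2) by (simp add: positive_op_def)
  have c4: "continuous_on ?I (\<lambda>t. sqrt (sqrt t))" and c2: "continuous_on ?I sqrt"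
    by (intro continuous_intros)+
  obtain p where p: "uniform_limit ?I (\<lambda>n. poly (p n)) (\<lambda>t. sqrt (sqrt t)) sequentially"
    using ex_poly_uniform_limit[OF compact_Icc c4] by blast
  have bdd: "bounded (f ` ?I)" if "continuous_on ?I f" for f :: "real \<Rightarrow> real"
    by (intro compact_imp_bounded compact_continuous_image that compact_Icc)
  have square: "uniform_limit ?I (\<lambda>n. poly (q n * q n)) f sequentially"
    if q: "uniform_limit ?I (\<lambda>n. poly (q n)) g sequentially" and g: "continuous_on ?I g"
      and f: "\<And>t. t \<in> ?I \<Longrightarrow> g t * g t = f t" for f g :: "real \<Rightarrow> real" and q
  proof -
    have "uniform_limit ?I (\<lambda>n t. poly (q n) t * poly (q n) t) (\<lambda>t. g t * g t) sequentially"
      by (intro uniform_lim_mult q bdd g)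
    also have "?this \<longleftrightarrow> ?thesis"
      by (intro uniform_limit_cong') (simp_all add: f)
    finally show ?thesis .
  qed
  have p2: "uniform_limit ?I (\<lambda>n. poly (p n * p n)) sqrt sequentially"
    by (rule square[OF p c4]) simp
  have p4: "uniform_limit ?I (\<lambda>n. poly (p n * p n * (p n * p n))) (\<lambda>t. t) sequentially"
    by (rule square[OF p2 c2]) simp
  note sub = positive_op_spectrum_subset[OF T]
  define R where "R = cfc (\<lambda>t. sqrt (sqrt t)) T"
  have R: "(\<lambda>n. poly_op (p n) T) \<longlonglongrightarrow> R"
    unfolding R_def
    by (intro poly_op_tendsto_cfc T sym uniform_limit_on_subset[OF p sub])
  have P: "(\<lambda>n. poly_op (p n * p n) T) \<longlonglongrightarrow> ?P"
    by (rule poly_op_tendsto_sqrt[OF T order_refl p2])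
  have "(\<lambda>n. poly_op (p n * p n) T) \<longlonglongrightarrow> (R o\<^sub>L R)"
    unfolding poly_op_mult
    by (intro bounded_bilinear.tendsto[OF bounded_bilinear_blinfun_compose] R)
  then have PR: "?P = R o\<^sub>L R"
    using P LIMSEQ_unique by blast
  show "?P \<in> bounded_operators"
    by (rule bounded_operators_tendsto[OF _ P]) (intro bounded_operators_poly_op T)
  have symR: "symmetric_op R"
    by (rule symmetric_op_tendsto[OF _ R]) (intro symmetric_op_poly_op sym)
  then show "positive_op ?P"
    unfolding PR by (intro positive_op_compose_adjoint) (simp add: symmetric_op_def)
  have PP: "(\<lambda>n. poly_op (p n * p n * (p n * p n)) T) \<longlonglongrightarrow> (?P o\<^sub>L ?P)"
    unfolding poly_op_mult[of "p _ * p _"]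
    by (intro bounded_bilinear.tendsto[OF bounded_bilinear_blinfun_compose] P)
  have id: "(\<lambda>n. poly_op (p n * p n * (p n * p n)) T) \<longlonglongrightarrow> cfc (\<lambda>t. t) T"
    by (intro poly_op_tendsto_cfc T sym uniform_limit_on_subset[OF p4 sub])
  \<comment> \<open>The constant sequence of the polynomial \<open>x\<close> evaluates the calculus
    at the identity function.\<close>
  have "(\<lambda>n::nat. poly_op [:0, 1:] T) \<longlonglongrightarrow> cfc (\<lambda>t. t) T"
    by (intro poly_op_tendsto_cfc T sym) (simp add: uniform_limit_iff)
  then have "cfc (\<lambda>t. t) T = T"
    by (simp add: LIMSEQ_const_iff poly_op_linear)
  then show "?P o\<^sub>L ?P = T"
    using LIMSEQ_unique[OF PP id] by simp
qed

text \<open>One sequence approximates \<open>sqrt\<close> on an interval containing both spectra;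
  its polynomials intertwine, and so do the limits.\<close>

lemma sqrt_op_intertwine:
  fixes T U X :: "'a::complex_hilbert_space \<Rightarrow>\<^sub>L 'a"
  assumes T: "T \<in> bounded_operators" "positive_op T" and U: "U \<in> bounded_operators" "positive_op U"
    and X: "X o\<^sub>L T = U o\<^sub>L X"
  shows "X o\<^sub>L powr_op T (1/2) = powr_op U (1/2) o\<^sub>L X"
proof -
  define M where "M = max (norm T) (norm U)"
  obtain p where p: "uniform_limit {0..M} (\<lambda>n. poly (p n)) sqrt sequentially"
    using ex_poly_uniform_limit[OF compact_Icc continuous_on_real_sqrt[OF continuous_on_id]] by blast
  have "(\<lambda>n. X o\<^sub>L poly_op (p n) T) \<longlonglongrightarrow> (X o\<^sub>L powr_op T (1/2))"
    by (intro bounded_bilinear.tendsto[OF bounded_bilinear_blinfun_compose] tendsto_const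
        poly_op_tendsto_sqrt[OF T _ p]) (simp add: M_def)
  moreover have "(\<lambda>n. poly_op (p n) U o\<^sub>L X) \<longlonglongrightarrow> (powr_op U (1/2) o\<^sub>L X)"
    by (intro bounded_bilinear.tendsto[OF bounded_bilinear_blinfun_compose] tendsto_const
        poly_op_tendsto_sqrt[OF U _ p]) (simp add: M_def)
  ultimately show ?thesis
    unfolding poly_op_intertwine[OF X] by (rule LIMSEQ_unique)
qed

subsection \<open>Norm inequalities\<close>

lemma blinfun_compose_assoc: "(T o\<^sub>L U) o\<^sub>L V = T o\<^sub>L (U o\<^sub>L V)"
  by (rule blinfun_eqI) simp

text \<open>On \<open>'b \<times> 'b\<close> put \<open>D = diag(P, Q)\<close> and let \<open>T\<close> have off-diagonal blocks \<open>X\<close>, \<open>Y\<close>. Since \<open>D\<close>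
  commutes with \<open>T\<close> and \<open>D\<^sup>2 = T\<^sup>2\<close>, \<open>H = D - T\<close> satisfies \<open>H\<^sup>2 = 2 D H\<close>, so \<open>H\<^sup>3\<close> is positive; then so is
  \<open>H\<close>, because \<open>H\<^sup>3 - t\<^sup>3 = (H\<^sup>2 + t H + t\<^sup>2) (H - t)\<close> is bounded below for \<open>t < 0\<close>.\<close>

lemma mixed_schwarz:
  fixes X Y P Q :: "'b::real_inner \<Rightarrow>\<^sub>L 'b"
  assumes XY: "\<And>u v. X v \<bullet> u = v \<bullet> Y u"
    and P: "positive_op P" "P o\<^sub>L P = X o\<^sub>L Y" and Q: "positive_op Q" "Q o\<^sub>L Q = Y o\<^sub>L X"
    and comm: "X o\<^sub>L Q = P o\<^sub>L X"
  shows "2 * (X v \<bullet> u) \<le> P u \<bullet> u + Q v \<bullet> v"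
proof -
  have symP: "P x \<bullet> y = x \<bullet> P y" and symQ: "Q x \<bullet> y = x \<bullet> Q y" for x y
    using P(1) Q(1) by (auto simp: positive_op_def symmetric_op_def)
  have PP: "P (P x) = X (Y x)" and QQ: "Q (Q x) = Y (X x)" and XQ: "X (Q x) = P (X x)" for x
    using arg_cong[OF P(2), of "\<lambda>F. blinfun_apply F x"]
      arg_cong[OF Q(2), of "\<lambda>F. blinfun_apply F x"]
      arg_cong[OF comm, of "\<lambda>F. blinfun_apply F x"] by simp_all
  \<comment> \<open>The adjoint of \<open>comm\<close>, the other half of the commutation of
    \<open>D\<close> with \<open>T\<close>.\<close>
  have YP: "Y (P x) = Q (Y x)" for x
    by (rule inner_right_cancel) (simp flip: XY symP symQ add: XQ)
  define h where "h = (\<lambda>z. (P (fst z) - X (snd z), Q (snd z) - Y (fst z)))"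
  have "bounded_linear h"
    unfolding h_def
    by (intro bounded_linear_Pair bounded_linear_sub
        bounded_linear_compose[OF blinfun.bounded_linear_right]
        bounded_linear_fst bounded_linear_snd)
  then have H: "blinfun_apply (Blinfun h) = h"
    by (rule bounded_linear_Blinfun_apply)
  define H where "H = Blinfun h"
  have Hz: "H z = (P (fst z) - X (snd z), Q (snd z) - Y (fst z))" for z
    by (simp add: H_def H) (simp add: h_def)
  have XY': "u \<bullet> X v = Y u \<bullet> v" for u v
    using XY[of v u] by (simp add: inner_commute)
  have symH: "symmetric_op H"
    by (simp add: symmetric_op_def Hz inner_prod_def inner_simps symP symQ XY XY')
  have HH: "H (H z) = (2 *\<^sub>R P (fst (H z)), 2 *\<^sub>R Q (snd (H z)))" for z
    by (simp add: Hz blinfun.diff_right PP QQ XQ YP scaleR_2)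
  \<comment> \<open>This is the form of \<open>H\<^sup>3\<close> at \<open>z\<close>; by
    \<open>HH\<close> it is twice the form of \<open>D\<close> at \<open>H z\<close>.\<close>
  have pos: "0 \<le> H (H z) \<bullet> H z" for z
    using P(1) Q(1) by (subst HH) (simp add: inner_prod_def positive_op_def)
  have "positive_op H"
  proof (rule positive_op_if_bounded_below[OF symH])
    fix t :: real assume t: "t < 0"
    define E where "E = ((H o\<^sub>L H) + t *\<^sub>R H + t\<^sup>2 *\<^sub>R id_blinfun) o\<^sub>L (H - t *\<^sub>R id_blinfun)"
    have E: "E z = H (H (H z)) - t ^ 3 *\<^sub>R z" for z
      by (simp add: E_def blinfun.bilinear_simps algebra_simps power2_eq_square power3_eq_cube)
    have "bounded_below E"
    proof (rule bounded_below_if_coercive)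
      show "- (t ^ 3) > 0"
        using t by (simp add: power_less_zero_eq)
      fix z
      have "E z \<bullet> z = H (H z) \<bullet> H z - t ^ 3 * (norm z)\<^sup>2"
        using symmetric_opD[OF symH, of "H (H z)" z]
        by (simp add: E inner_simps power2_norm_eq_inner)
      then show "- (t ^ 3) * (norm z)\<^sup>2 \<le> \<bar>E z \<bullet> z\<bar>"
        using pos[of z] by linarith
    qed
    then show "bounded_below (H - t *\<^sub>R id_blinfun)"
      unfolding E_def by (rule bounded_below_right_factor)
  qed
  then have "0 \<le> H (u, v) \<bullet> (u, v)"
    by (simp add: positive_op_def)
  also have "\<dots> = P u \<bullet> u + Q v \<bullet> v - 2 * (X v \<bullet> u)"
    using XY[of v u] by (simp add: Hz inner_prod_def inner_simps inner_commute)
  finally show ?thesis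
    by simp
qed

text \<open>The roots are \<open>|Y|\<close> and \<open>|X|\<close>; the relation
  \<open>X (Y X) = (X Y) X\<close> passes to them.\<close>

lemma sqrt_mixed_schwarz:
  fixes X Y :: "'a::complex_hilbert_space \<Rightarrow>\<^sub>L 'a"
  assumes X: "X \<in> bounded_operators" and XY: "\<And>u v. X v \<bullet> u = v \<bullet> Y u"
  shows "2 * (X v \<bullet> u) \<le> powr_op (X o\<^sub>L Y) (1/2) u \<bullet> u + powr_op (Y o\<^sub>L X) (1/2) v \<bullet> v"
proof -
  have Y: "Y \<in> bounded_operators"
    by (rule bounded_operators_real_adjoint[OF X XY])
  have "Y v \<bullet> u = v \<bullet> X u" for u v
    using XY[of u v] by (simp add: inner_commute)
  then have P: "X o\<^sub>L Y \<in> bounded_operators" "positive_op (X o\<^sub>L Y)"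
    by (intro bounded_operators_compose X Y positive_op_compose_adjoint)+
  have Q: "Y o\<^sub>L X \<in> bounded_operators" "positive_op (Y o\<^sub>L X)"
    by (intro bounded_operators_compose X Y positive_op_compose_adjoint XY)+
  have "X o\<^sub>L (Y o\<^sub>L X) = (X o\<^sub>L Y) o\<^sub>L X"
    by (simp add: blinfun_compose_assoc)
  then show ?thesis
    by (intro mixed_schwarz[OF XY positive_sqrt_op[OF P] sqrt_op_square[OF P]
          positive_sqrt_op[OF Q] sqrt_op_square[OF Q]] sqrt_op_intertwine P Q)
qed

text \<open>\<open>A + B = L L\<^sup>*\<close> for the row \<open>L = (E, F)\<close>, and \<open>L\<^sup>* L\<close> has diagonal blocks \<open>A\<close>, \<open>B\<close>
  and off-diagonal block \<open>E F\<close>, which is dominated by \<open>diag(P, Q)\<close>.\<close>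

lemma norm_add_positive_le:
  fixes A B E F P Q :: "'b::real_inner \<Rightarrow>\<^sub>L 'b"
  assumes E: "symmetric_op E" "E o\<^sub>L E = A" and F: "symmetric_op F" "F o\<^sub>L F = B"
    and mixed: "\<And>u v. 2 * (E (F v) \<bullet> u) \<le> P u \<bullet> u + Q v \<bullet> v"
    and N: "norm (A + P) \<le> N" "norm (B + Q) \<le> N"
  shows "norm (A + B) \<le> N"
proof (rule norm_blinfun_bound)
  show N0: "0 \<le> N"
    by (rule order_trans[OF norm_ge_zero N(1)])
  fix x
  define w where "w = (A + B) x"
  \<comment> \<open>The pair \<open>(u, v)\<close> is \<open>L\<^sup>* x\<close>, so
    \<open>w\<close> is its image under \<open>L\<close>, \<open>w \<bullet> x\<close> its squared
    norm, and \<open>(norm w)\<^sup>2\<close> the form of \<open>L\<^sup>* L\<close> at it.\<close>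
  define u v where "u = E x" and "v = F x"
  have EA: "E (E y) = A y" and FB: "F (F y) = B y" for y
    using E(2) F(2) by auto
  have w: "w = E u + F v"
    by (simp add: w_def u_def v_def EA FB blinfun.add_left)
  have uv: "(norm u)\<^sup>2 + (norm v)\<^sup>2 = w \<bullet> x"
    using symmetric_opD[OF E(1), of u x] symmetric_opD[OF F(1), of v x]
    by (simp add: w inner_simps u_def v_def power2_norm_eq_inner)
  have quad: "T y \<bullet> y \<le> N * (norm y)\<^sup>2" if "norm T \<le> N" for T :: "'b \<Rightarrow>\<^sub>L 'b" and y
    using blinfun_inner_bound[of T y] mult_right_mono[OF that, of "(norm y)\<^sup>2"] by simp
  have "(norm w)\<^sup>2 = A u \<bullet> u + 2 * (E (F v) \<bullet> u) + B v \<bullet> v"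
    using symmetric_opD[OF E(1), of "E u" u] symmetric_opD[OF F(1), of "F v" v]
      symmetric_opD[OF E(1), of "F v" u]
    by (simp add: w power2_norm_eq_inner inner_simps inner_commute flip: EA FB)
  also have "\<dots> \<le> (A + P) u \<bullet> u + (B + Q) v \<bullet> v"
    using mixed[of v u] by (simp add: blinfun.add_left inner_simps)
  also have "\<dots> \<le> N * (norm u)\<^sup>2 + N * (norm v)\<^sup>2"
    by (intro add_mono quad N)
  also have "\<dots> = N * (w \<bullet> x)"
    by (simp add: distrib_left flip: uv)
  also have "\<dots> \<le> N * (norm w * norm x)"
    by (intro mult_left_mono norm_cauchy_schwarz N0)
  finally have "norm w * norm w \<le> norm w * (N * norm x)"
    by (simp add: power2_eq_square algebra_simps)
  then show "norm ((A + B) x) \<le> N * norm x"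
    using N0 by (cases "w = 0") (auto simp: w_def)
qed

text \<open>Otherwise \<open>norm G - G\<close> would be coercive, and the form of \<open>G\<close>
  would obey a bound smaller than \<open>norm G\<close>.\<close>

lemma not_bounded_below_minus_norm:
  fixes G :: "'b::real_inner \<Rightarrow>\<^sub>L 'b"
  assumes G: "positive_op G" "G \<noteq> 0"
  shows "\<not> bounded_below (G - norm G *\<^sub>R id_blinfun)"
proof
  assume bb: "bounded_below (G - norm G *\<^sub>R id_blinfun)"
  have "positive_op (norm G *\<^sub>R id_blinfun - G)"
    using G(1) blinfun_inner_bound[of G]
    by (auto simp: positive_op_def blinfun.bilinear_simps inner_simps abs_le_iff
        power2_norm_eq_inner intro!: symmetric_op_intros)
  moreover have "bounded_below (norm G *\<^sub>R id_blinfun - G)"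
    using bb by (simp add: bounded_below_def blinfun.diff_left norm_minus_commute)
  ultimately obtain \<delta> where \<delta>: "\<delta> > 0"
    "\<And>x. \<delta> * (norm x)\<^sup>2 \<le> (norm G *\<^sub>R id_blinfun - G) x \<bullet> x"
    using positive_op_coercive_if_bounded_below by blast
  \<comment> \<open>The maximum makes the bound nonnegative, as \<open>norm_symmetric_op_le\<close>
    requires; the value 0 contradicts \<open>G \<noteq> 0\<close>.\<close>
  have "norm G \<le> max 0 (norm G - \<delta>)"
  proof (rule norm_symmetric_op_le)
    fix x
    have "G x \<bullet> x \<le> (norm G - \<delta>) * (norm x)\<^sup>2"
      using \<delta>(2)[of x]
      by (simp add: blinfun.bilinear_simps inner_simps power2_norm_eq_inner algebra_simps)
    also have "\<dots> \<le> max 0 (norm G - \<delta>) * (norm x)\<^sup>2"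
      by (intro mult_right_mono) auto
    finally show "\<bar>G x \<bullet> x\<bar> \<le> max 0 (norm G - \<delta>) * (norm x)\<^sup>2"
      using G(1) by (simp add: positive_op_def)
  qed (use G(1) in \<open>auto simp: positive_op_def\<close>)
  then show False
    using \<delta>(1) G(2) by (simp add: max_def split: if_splits)
qed

text \<open>The nonzero spectra of \<open>Y Z\<close> and \<open>Z Y\<close> agree: a left inverse \<open>R\<close> of \<open>Z Y - \<mu>\<close> yields
  \<open>\<mu> x = Y R Z w - w\<close> for \<open>w = (Y Z - \<mu>) x\<close>.\<close>

lemma norm_le_spectral_radius:
  fixes Y Z :: "'a::complex_hilbert_space \<Rightarrow>\<^sub>L 'a"
  assumes K: "Z o\<^sub>L Y \<in> bounded_operators" and G: "positive_op (Y o\<^sub>L Z)"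
  shows "norm (Y o\<^sub>L Z) \<le> spectral_radius (Z o\<^sub>L Y)"
proof -
  define \<mu> where "\<mu> = norm (Y o\<^sub>L Z)"
  have bdd: "bdd_above (insert 0 (cmod ` spectrum (Z o\<^sub>L Y)))"
    using cmod_le_norm_if_in_spectrum[OF K] by (intro bdd_aboveI[of _ "norm (Z o\<^sub>L Y)"]) auto
  \<comment> \<open>The inserted 0 covers \<open>\<mu> = 0\<close>, where \<open>\<mu>\<close> need
    not come from the spectrum.\<close>
  have "\<mu> \<in> insert 0 (cmod ` spectrum (Z o\<^sub>L Y))"
  proof (cases "\<mu> = 0")
    case False
    then have \<mu>: "\<mu> > 0"
      by (simp add: \<mu>_def)
    have "complex_of_real \<mu> \<in> spectrum (Z o\<^sub>L Y)"
    proof (rule ccontr)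
      assume "complex_of_real \<mu> \<notin> spectrum (Z o\<^sub>L Y)"
      then obtain R where "R o\<^sub>L ((Z o\<^sub>L Y) - scalar_op (complex_of_real \<mu>)) = id_blinfun"
        unfolding spectrum_def by blast
      then have R: "R o\<^sub>L ((Z o\<^sub>L Y) - \<mu> *\<^sub>R id_blinfun) = id_blinfun"
        unfolding scalar_op_of_real .
      have RZY: "R (Z (Y y) - \<mu> *\<^sub>R y) = y" for y
        using arg_cong[OF R, of "\<lambda>F. blinfun_apply F y"] by (simp add: blinfun.bilinear_simps)
      define C where "C = norm ((Y o\<^sub>L R o\<^sub>L Z) - id_blinfun) + 1"
      have C: "C > 0"
        unfolding C_def by (intro add_nonneg_pos) auto
      have "bounded_below ((Y o\<^sub>L Z) - \<mu> *\<^sub>R id_blinfun)"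
        unfolding bounded_below_def
      proof (intro exI[of _ "\<mu> / C"] conjI allI)
        fix x
        define w where "w = Y (Z x) - \<mu> *\<^sub>R x"
        \<comment> \<open>Because \<open>(Z Y - \<mu>) (Z x) = Z w\<close>.\<close>
        have "R (Z w) = Z x"
          using RZY[of "Z x"] by (simp add: w_def blinfun.bilinear_simps)
        then have "\<mu> *\<^sub>R x = ((Y o\<^sub>L R o\<^sub>L Z) - id_blinfun) w"
          by (simp add: blinfun.diff_left) (simp add: w_def)
        then have "\<mu> * norm x = norm (((Y o\<^sub>L R o\<^sub>L Z) - id_blinfun) w)"
          using \<mu> by (metis abs_of_pos norm_scaleR)
        also have "\<dots> \<le> norm ((Y o\<^sub>L R o\<^sub>L Z) - id_blinfun) * norm w"
          by (rule norm_blinfun)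
        also have "\<dots> \<le> C * norm w"
          by (intro mult_right_mono) (auto simp: C_def)
        finally show "\<mu> / C * norm x \<le> norm (((Y o\<^sub>L Z) - \<mu> *\<^sub>R id_blinfun) x)"
          using C by (simp add: w_def blinfun.bilinear_simps field_simps)
      qed (use \<mu> C in simp)
      then show False
        using not_bounded_below_minus_norm[OF G] False by (simp add: \<mu>_def)
    qed
    then show ?thesis
      using \<mu> by (force simp: image_iff)
  qed simp
  then show ?thesis
    unfolding spectral_radius_def \<mu>_def using bdd by (intro cSup_upper)
qed

section \<open>Norms of roots and absolute values, and the numerical radius\<close>

lemma norm_sqrt_op:
  fixes T :: "'a::complex_hilbert_space \<Rightarrow>\<^sub>L 'a"
  assumes T: "T \<in> bounded_operators" "positive_op T"
  shows "norm (powr_op T (1/2)) \<le> sqrt (norm T)"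
proof (rule norm_blinfun_bound)
  fix x
  let ?P = "powr_op T (1/2)"
  have "symmetric_op ?P"
    using positive_sqrt_op[OF T] by (simp add: positive_op_def)
  then have "(norm (?P x))\<^sup>2 = ?P (?P x) \<bullet> x"
    by (simp add: symmetric_op_def power2_norm_eq_inner)
  also have "?P (?P x) = T x"
    using arg_cong[OF sqrt_op_square[OF T], of "\<lambda>F. blinfun_apply F x"] by simp
  also have "T x \<bullet> x \<le> (sqrt (norm T) * norm x)\<^sup>2"
    using blinfun_inner_bound[of T x] by (simp add: power_mult_distrib)
  finally show "norm (?P x) \<le> sqrt (norm T) * norm x"
    by (rule power2_le_imp_le) simp
qed simp

lemma adj_compose_self:
  assumes S: "S \<in> bounded_operators"
  shows bounded_operators_adj_compose: "adj S o\<^sub>L S \<in> bounded_operators"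
    and positive_adj_compose: "positive_op (adj S o\<^sub>L S)"
proof -
  show "adj S o\<^sub>L S \<in> bounded_operators"
    by (rule bounded_operators_compose[OF bounded_operators_adj[OF S] S])
  show "positive_op (adj S o\<^sub>L S)"
    by (rule positive_op_compose_adjoint) (rule adj_inner[OF S])
qed

lemma abs_op:
  assumes S: "S \<in> bounded_operators"
  shows bounded_operators_abs_op: "abs_op S \<in> bounded_operators"
    and positive_abs_op: "positive_op (abs_op S)"
proof -
  note T = bounded_operators_adj_compose[OF S] positive_adj_compose[OF S]
  show "abs_op S \<in> bounded_operators"
    unfolding abs_op_def by (rule bounded_operators_sqrt_op[OF T])
  show "positive_op (abs_op S)"
    unfolding abs_op_def by (rule positive_sqrt_op[OF T])
qed

lemma norm_abs_op_le:
  assumes S: "S \<in> bounded_operators"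
  shows "norm (abs_op S) \<le> norm S"
proof -
  have "norm (abs_op S) \<le> sqrt (norm (adj S o\<^sub>L S))"
    unfolding abs_op_def by (rule norm_sqrt_op[OF bounded_operators_adj_compose[OF S] positive_adj_compose[OF S]])
  also have "\<dots> \<le> sqrt (norm S * norm S)"
    using norm_blinfun_compose[of "adj S" S] mult_right_mono[OF norm_adj_le[OF S], of "norm S"]
    by (intro real_sqrt_le_mono) auto
  finally show ?thesis
    by simp
qed

text \<open>A phase \<open>c\<close> turns the modulus of \<open>cinner (S x) x\<close> into
  \<open>S (c *\<^sub>C x) \<bullet> x\<close>, to which the mixed Schwarz inequality
  applies.\<close>

lemma numerical_radius_le:
  assumes S: "S \<in> bounded_operators"
  shows "numerical_radius S \<le> 1/2 * norm (abs_op (adj S) + abs_op S)"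
  unfolding numerical_radius_def
proof (rule cSup_least)
  let ?A = "abs_op (adj S)" and ?B = "abs_op S"
  have mixed: "2 * (S v \<bullet> u) \<le> ?A u \<bullet> u + ?B v \<bullet> v" for u v
    using sqrt_mixed_schwarz[OF S adj_inner[OF S], of v u] by (simp add: abs_op_def adj_adj[OF S])
  have B: "?B \<in> bounded_operators"
    by (rule bounded_operators_abs_op[OF S])
  fix r assume "r \<in> insert 0 {cmod (cinner (S x) x) |x. norm x = 1}"
  then consider "r = 0" | x where "norm x = 1" "r = cmod (cinner (S x) x)"
    by blast
  then show "r \<le> 1/2 * norm (?A + ?B)"
  proof cases
    case 2
    define z where "z = cinner (S x) x"
    \<comment> \<open>The value 1 at \<open>z = 0\<close> keeps \<open>cmod c = 1\<close>, so the
      form of \<open>?B\<close> is the same at \<open>c *\<^sub>C x\<close> as at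
      \<open>x\<close>.\<close>
    define c where "c = (if z = 0 then 1 else cnj z / cmod z)"
    have "cmod c = 1"
      by (simp add: c_def norm_divide)
    then have cc: "cnj c * c = 1"
      by (metis complex_norm_square mult.commute of_real_1 power_one)
    have cz: "c * z = cmod z"
      by (auto simp: c_def mult.commute power2_eq_square simp flip: complex_norm_square)
    have "r = S (c *\<^sub>C x) \<bullet> x"
      by (simp add: 2 bounded_operatorsD[OF S] cinner_scaleC_left cz flip: Re_cinner z_def)
    then have "2 * r \<le> ?A x \<bullet> x + ?B (c *\<^sub>C x) \<bullet> (c *\<^sub>C x)"
      using mixed[of "c *\<^sub>C x" x] by simp
    also have "?B (c *\<^sub>C x) \<bullet> (c *\<^sub>C x) = ?B x \<bullet> x"
      using scaleC_of_real[of 1 x]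
      by (simp add: bounded_operatorsD[OF B] inner_scaleC scaleC_scaleC cc)
    also have "?A x \<bullet> x + ?B x \<bullet> x \<le> norm (?A + ?B)"
      using blinfun_inner_bound[of "?A + ?B" x] 2(1)
      by (simp add: blinfun.add_left inner_simps)
    finally show ?thesis
      by simp
  qed simp
qed simp

theorem corollary2p2:
  fixes S :: "'a::complex_hilbert_space \<Rightarrow>\<^sub>L 'a"
  assumes "S \<in> bounded_operators"
  shows "numerical_radius S \<le>
      1/2 * max
        (norm (abs_op (adj S) +
           powr_op (powr_op (abs_op (adj S)) (1/2) o\<^sub>L abs_op S o\<^sub>L powr_op (abs_op (adj S)) (1/2)) (1/2)))
        (norm (abs_op S +
           powr_op (powr_op (abs_op S) (1/2) o\<^sub>L abs_op (adj S) o\<^sub>L powr_op (abs_op S) (1/2)) (1/2)))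
    \<and> 1/2 * max
        (norm (abs_op (adj S) +
           powr_op (powr_op (abs_op (adj S)) (1/2) o\<^sub>L abs_op S o\<^sub>L powr_op (abs_op (adj S)) (1/2)) (1/2)))
        (norm (abs_op S +
           powr_op (powr_op (abs_op S) (1/2) o\<^sub>L abs_op (adj S) o\<^sub>L powr_op (abs_op S) (1/2)) (1/2)))
      \<le> 1/2 * (norm S + sqrt (spectral_radius (abs_op S o\<^sub>L abs_op (adj S))))"
proof -
  define A B E F where "A = abs_op (adj S)" and "B = abs_op S"
    and "E = powr_op A (1/2)" and "F = powr_op B (1/2)"
  have A: "A \<in> bounded_operators" "positive_op A" and B: "B \<in> bounded_operators" "positive_op B"
    unfolding A_def B_def by (intro abs_op bounded_operators_adj assms)+
  have E: "E \<in> bounded_operators" "symmetric_op E" "E o\<^sub>L E = A"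
    using sqrt_op[OF A] by (auto simp: E_def positive_op_def)
  have F: "F \<in> bounded_operators" "symmetric_op F" "F o\<^sub>L F = B"
    using sqrt_op[OF B] by (auto simp: F_def positive_op_def)
  have EF: "(E o\<^sub>L F) v \<bullet> u = v \<bullet> (F o\<^sub>L E) u" for u v
    using E(2) F(2) by (simp add: symmetric_op_def)
  have FE: "(F o\<^sub>L E) v \<bullet> u = v \<bullet> (E o\<^sub>L F) u" for u v
    using E(2) F(2) by (simp add: symmetric_op_def)
  have EE: "E (E x) = A x" and FF: "F (F x) = B x" for x
    using E(3) F(3) by auto
  \<comment> \<open>Both are products of \<open>E F\<close> with its adjoint \<open>F E\<close>, so
    \<open>P\<close> and \<open>Q\<close> below are the absolute values of \<open>F E\<close> and
    \<open>E F\<close>.\<close>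
  have EBE: "E o\<^sub>L B o\<^sub>L E = (E o\<^sub>L F) o\<^sub>L (F o\<^sub>L E)"
    and FAF: "F o\<^sub>L A o\<^sub>L F = (F o\<^sub>L E) o\<^sub>L (E o\<^sub>L F)"
    by (auto intro!: blinfun_eqI simp: EE FF)
  define P Q where "P = powr_op (E o\<^sub>L B o\<^sub>L E) (1/2)" and "Q = powr_op (F o\<^sub>L A o\<^sub>L F) (1/2)"
  define N where "N = max (norm (A + P)) (norm (B + Q))"
  have "norm (A + B) \<le> N"
  proof (rule norm_add_positive_le[OF E(2,3) F(2,3)])
    show "2 * (E (F v) \<bullet> u) \<le> P u \<bullet> u + Q v \<bullet> v" for u v
      using sqrt_mixed_schwarz[OF bounded_operators_compose[OF E(1) F(1)] EF, of v u]
      by (simp add: P_def Q_def EBE FAF)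
  qed (auto simp: N_def)
  then have 1: "numerical_radius S \<le> 1/2 * N"
    using numerical_radius_le[OF assms] by (simp add: A_def B_def)
  have posP: "positive_op (E o\<^sub>L B o\<^sub>L E)" and posQ: "positive_op (F o\<^sub>L A o\<^sub>L F)"
    unfolding EBE FAF by (intro positive_op_compose_adjoint EF FE)+
  define \<rho> where "\<rho> = spectral_radius (B o\<^sub>L A)"
  have BA: "B o\<^sub>L A \<in> bounded_operators"
    by (intro bounded_operators_compose A B)
  \<comment> \<open>With \<open>Y = E\<close> and \<open>Z = B E\<close> the swapped product is
    \<open>B E E = B A\<close>.\<close>
  have "norm (E o\<^sub>L (B o\<^sub>L E)) \<le> spectral_radius ((B o\<^sub>L E) o\<^sub>L E)"
    using BA posP by (intro norm_le_spectral_radius) (simp_all add: blinfun_compose_assoc E(3))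
  then have "norm (E o\<^sub>L B o\<^sub>L E) \<le> \<rho>"
    by (simp add: \<rho>_def blinfun_compose_assoc E(3))
  then have P: "norm P \<le> sqrt \<rho>"
    unfolding P_def using posP
    by (intro order_trans[OF norm_sqrt_op] real_sqrt_le_mono bounded_operators_compose E B)
  \<comment> \<open>Here \<open>Y = F A\<close> and \<open>Z = F\<close>; the swapped product
    \<open>F F A\<close> is again \<open>B A\<close>, so one spectral radius bounds both
    roots.\<close>
  have "norm ((F o\<^sub>L A) o\<^sub>L F) \<le> spectral_radius (F o\<^sub>L (F o\<^sub>L A))"
    using BA posQ by (intro norm_le_spectral_radius) (simp_all flip: blinfun_compose_assoc add: F(3))
  then have "norm (F o\<^sub>L A o\<^sub>L F) \<le> \<rho>"
    by (simp add: \<rho>_def F(3) flip: blinfun_compose_assoc)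
  then have Q: "norm Q \<le> sqrt \<rho>"
    unfolding Q_def using posQ
    by (intro order_trans[OF norm_sqrt_op] real_sqrt_le_mono bounded_operators_compose F A)
  have "norm A \<le> norm S"
    unfolding A_def
    by (rule order_trans[OF norm_abs_op_le[OF bounded_operators_adj[OF assms]] norm_adj_le[OF assms]])
  moreover have "norm B \<le> norm S"
    unfolding B_def by (rule norm_abs_op_le[OF assms])
  ultimately have 2: "N \<le> norm S + sqrt \<rho>"
    using P Q norm_triangle_ineq[of A P] norm_triangle_ineq[of B Q] unfolding N_def by linarith
  show ?thesis
    using 1 2 unfolding N_def P_def Q_def \<rho>_def E_def F_def A_def B_def by simp
qed


end
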